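(* Let $\mathcal{F}$ be a Furstenberg family, let $\Omega\subset \mathbb{C}$ be an infinitely connected domain, let $N\geq 2$, and let $\phi_1,\dots,\phi_N$ be injective holomorphic self-maps of $\Omega$. Then the following assertions are equivalent: (1) The composition operators $C_{\phi_1},\dots,C_{\phi_N}$ on $H(\Omega)$ are disjoint $\mathcal{F}$-transitive. (2) For every $\Omega$-convex compact subset $K$ of $\Omega$, the set $$\{n \in \mathbb{N}:\ \phi_{i,n}(K)\text{ is }\Omega\text{-convex for every } i=1,\dots,N,\text{ and } K,\phi_{1,n}(K),\dots,\phi_{N,n}(K)\text{ are pairwise disjoint}\}$$ belongs to $\mathcal{F}$.
   Context: $\mathbb{N}$ denotes the set of positive integers and $\hat{\mathbb{C}}=\mathbb{C}\cup\{\infty\}$. A Furstenberg family is a non-empty collection $\mathcal{F}$ of subsets of $\mathbb{N}$ such that $\emptyset\notin\mathcal{F}$ and, if $A\in\mathcal{F}$ and $A\subset B\subset\mathbb{N}$, then $B\in\mathcal{F}$. A domain is a non-empty connected open subset $\Omega$ of $\mathbb{C}$; it is finitely connected if $\hat{\mathbb{C}}\setminus\Omega$ has at most finitely many connected components, and infinitely connected otherwise. For $M\subset\mathbb{C}$, a hole of $M$ is a bounded connected component of $\hat{\mathbb{C}}\setminus M$ (in particular, one not containing $\infty$). A compact subset $M$ of $\Omega$ is $\Omega$-convex if every hole of $M$ contains a point of $\mathbb{C}\setminus\Omega$. $H(\Omega)$ is the space of holomorphic functions on $\Omega$ with the topology of uniform convergence on compact subsets. For a holomorphic self-map $\phi$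 of $\Omega$, $C_\phi(f)=f\circ\phi$ for $f\in H(\Omega)$. $\phi_{i,n}$ denotes the $n$-th iterate of $\phi_i$. Continuous linear operators $T_1,\dots,T_N$ on a topological vector space $X$ are disjoint $\mathcal{F}$-transitive if for all non-empty open subsets $U_0,\dots,U_N$ of $X$ the set $\{n\in\mathbb{N}:\ U_0\cap T_1^{-n}(U_1)\cap\dots\cap T_N^{-n}(U_N)\neq\emptyset\}$ belongs to $\mathcal{F}$, where $T_i^{-n}(U_i)$ is the preimage of $U_i$ under $T_i^n$. *)

theory Defs
  imports "HOL-Analysis.Analysis"
begin

definition furstenberg_family :: "nat set set \<Rightarrow> bool" where
  "furstenberg_family F \<longleftrightarrow>
     F \<noteq> {} \<and> (\<forall>A\<in>F. A \<subseteq> {1..}) \<and> {} \<notin> F \<and>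
     (\<forall>A B. A \<in> F \<and> A \<subseteq> B \<and> B \<subseteq> {1..} \<longrightarrow> B \<in> F)"

text \<open>The extended plane: \<^term>\<open>Some z\<close> is the point z of the plane and \<^term>\<open>None\<close> is the
  point at infinity.\<close>

definition riemann_sphere :: "complex option topology" where
  "riemann_sphere = Alexandroff_compactification euclidean"

definition sphere_complement_components :: "complex set \<Rightarrow> complex option set set" where
  "sphere_complement_components M =
     connected_components_of (subtopology riemann_sphere (topspace riemann_sphere - Some ` M))"

definition plane_domain :: "complex set \<Rightarrow> bool" where
  "plane_domain \<Omega> \<longleftrightarrow> \<Omega> \<noteq> {} \<and> open \<Omega> \<and> connected \<Omega>"

definition finitely_connected :: "complex set \<Rightarrow> bool" where
  "finitely_connected \<Omega> \<longleftrightarrow> finite (sphere_complement_components \<Omega>)"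

text \<open>Holes are recorded as subsets of the plane: a component of the form \<^term>\<open>Some ` B\<close> is one
  that misses the point at infinity.\<close>

definition holes :: "complex set \<Rightarrow> complex set set" where
  "holes M = {B. Some ` B \<in> sphere_complement_components M \<and> bounded B}"

definition convex_relative :: "complex set \<Rightarrow> complex set \<Rightarrow> bool" where
  "convex_relative \<Omega> M \<longleftrightarrow> compact M \<and> M \<subseteq> \<Omega> \<and> (\<forall>B\<in>holes M. \<exists>z\<in>B. z \<notin> \<Omega>)"

text \<open>A holomorphic function on \<^term>\<open>\<Omega>\<close> is represented by its unique representative in
  \<^term>\<open>extensional \<Omega>\<close>, so that equality in the space is equality on \<^term>\<open>\<Omega>\<close>.\<close>

definition holomorphic_functions :: "complex set \<Rightarrow> (complex \<Rightarrow> complex) set" where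
  "holomorphic_functions \<Omega> = {f. f holomorphic_on \<Omega> \<and> f \<in> extensional \<Omega>}"

definition holomorphic_nhd ::
    "complex set \<Rightarrow> (complex \<Rightarrow> complex) \<Rightarrow> complex set \<Rightarrow> real \<Rightarrow> (complex \<Rightarrow> complex) set" where
  "holomorphic_nhd \<Omega> f K \<epsilon> =
     {g \<in> holomorphic_functions \<Omega>. \<forall>z\<in>K. dist (g z) (f z) < \<epsilon>}"

definition holomorphic_topology :: "complex set \<Rightarrow> (complex \<Rightarrow> complex) topology" where
  "holomorphic_topology \<Omega> = topology (\<lambda>U. U \<subseteq> holomorphic_functions \<Omega> \<and>
     (\<forall>f\<in>U. \<exists>K \<epsilon>. compact K \<and> K \<subseteq> \<Omega> \<and> \<epsilon> > 0 \<and> holomorphic_nhd \<Omega> f K \<epsilon> \<subseteq> U))"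

lemma openin_holomorphic_topology:
  "openin (holomorphic_topology \<Omega>) U \<longleftrightarrow> U \<subseteq> holomorphic_functions \<Omega> \<and>
     (\<forall>f\<in>U. \<exists>K \<epsilon>. compact K \<and> K \<subseteq> \<Omega> \<and> \<epsilon> > 0 \<and> holomorphic_nhd \<Omega> f K \<epsilon> \<subseteq> U)"
proof -
  let ?P = "\<lambda>U. U \<subseteq> holomorphic_functions \<Omega> \<and>
     (\<forall>f\<in>U. \<exists>K \<epsilon>. compact K \<and> K \<subseteq> \<Omega> \<and> \<epsilon> > 0 \<and> holomorphic_nhd \<Omega> f K \<epsilon> \<subseteq> U)"
  have "?P (S \<inter> T)" if S: "?P S" and T: "?P T" for S T
  proof (intro conjI ballI)
    show "S \<inter> T \<subseteq> holomorphic_functions \<Omega>" using S by blast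
    fix f assume f: "f \<in> S \<inter> T"
    obtain K \<epsilon> where 1: "compact K" "K \<subseteq> \<Omega>" "\<epsilon> > 0" "holomorphic_nhd \<Omega> f K \<epsilon> \<subseteq> S"
      using S f by blast
    obtain L \<delta> where 2: "compact L" "L \<subseteq> \<Omega>" "\<delta> > 0" "holomorphic_nhd \<Omega> f L \<delta> \<subseteq> T"
      using T f by blast
    have "holomorphic_nhd \<Omega> f (K \<union> L) (min \<epsilon> \<delta>) \<subseteq> S \<inter> T"
      using 1(4) 2(4) unfolding holomorphic_nhd_def by (simp add: subset_iff)
    then show "\<exists>K \<epsilon>. compact K \<and> K \<subseteq> \<Omega> \<and> \<epsilon> > 0 \<and> holomorphic_nhd \<Omega> f K \<epsilon> \<subseteq> S \<inter> T"
      using 1 2 by (intro exI[of _ "K \<union> L"] exI[of _ "min \<epsilon> \<delta>"]) auto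
  qed
  moreover have "?P (\<Union>\<K>)" if all: "\<forall>S\<in>\<K>. ?P S" for \<K>
  proof (intro conjI ballI)
    show "\<Union>\<K> \<subseteq> holomorphic_functions \<Omega>" using all by blast
    fix f assume "f \<in> \<Union>\<K>"
    then obtain S where S: "S \<in> \<K>" "f \<in> S" by blast
    then obtain K \<epsilon> where "compact K" "K \<subseteq> \<Omega>" "\<epsilon> > 0" "holomorphic_nhd \<Omega> f K \<epsilon> \<subseteq> S"
      using bspec[OF all S(1)] by blast
    moreover from this have "holomorphic_nhd \<Omega> f K \<epsilon> \<subseteq> \<Union>\<K>" using S(1) by blast
    ultimately show "\<exists>K \<epsilon>. compact K \<and> K \<subseteq> \<Omega> \<and> \<epsilon> > 0 \<and> holomorphic_nhd \<Omega> f K \<epsilon> \<subseteq> \<Union>\<K>"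
      by blast
  qed
  ultimately have "istopology ?P" unfolding istopology_def by (iprover)
  then have "openin (topology ?P) = ?P" by (rule topology_inverse')
  then show ?thesis by (subst holomorphic_topology_def) (rule fun_cong)
qed

lemma topspace_holomorphic_topology [simp]:
  "topspace (holomorphic_topology \<Omega>) = holomorphic_functions \<Omega>"
proof -
  have "openin (holomorphic_topology \<Omega>) (holomorphic_functions \<Omega>)"
    unfolding openin_holomorphic_topology holomorphic_nhd_def
    by (intro conjI ballI exI[of _ "{}"] exI[of _ "1::real"]) auto
  moreover have "topspace (holomorphic_topology \<Omega>) \<subseteq> holomorphic_functions \<Omega>"
    using openin_holomorphic_topology openin_topspace by blast
  ultimately show ?thesis by (meson openin_subset subset_antisym)
qed

definition composition_operator ::
    "complex set \<Rightarrow> (complex \<Rightarrow> complex) \<Rightarrow> (complex \<Rightarrow> complex) \<Rightarrow> (complex \<Rightarrow> complex)" where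
  "composition_operator \<Omega> \<phi> f = restrict (f \<circ> \<phi>) \<Omega>"

lemma continuous_map_composition_operator:
  assumes "\<phi> holomorphic_on \<Omega>" "\<phi> ` \<Omega> \<subseteq> \<Omega>"
  shows "continuous_map (holomorphic_topology \<Omega>) (holomorphic_topology \<Omega>)
           (composition_operator \<Omega> \<phi>)"
proof -
  let ?C = "composition_operator \<Omega> \<phi>"
  have C: "?C f \<in> holomorphic_functions \<Omega>" if "f \<in> holomorphic_functions \<Omega>" for f
  proof -
    have "(f \<circ> \<phi>) holomorphic_on \<Omega>"
      using that assms holomorphic_on_compose_gen unfolding holomorphic_functions_def by blast
    then have "?C f holomorphic_on \<Omega>"
      unfolding composition_operator_def by (rule holomorphic_transform) auto
    then show ?thesis by (simp add: holomorphic_functions_def composition_operator_def)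
  qed
  have "openin (holomorphic_topology \<Omega>) {f \<in> holomorphic_functions \<Omega>. ?C f \<in> U}"
    if U: "openin (holomorphic_topology \<Omega>) U" for U
    unfolding openin_holomorphic_topology
  proof (intro conjI ballI)
    fix f assume f: "f \<in> {f \<in> holomorphic_functions \<Omega>. ?C f \<in> U}"
    then obtain K \<epsilon> where K: "compact K" "K \<subseteq> \<Omega>" "\<epsilon> > 0" "holomorphic_nhd \<Omega> (?C f) K \<epsilon> \<subseteq> U"
      using U unfolding openin_holomorphic_topology by blast
    have "compact (\<phi> ` K)"
      using K assms(1) by (meson compact_continuous_image continuous_on_subset
          holomorphic_on_imp_continuous_on)
    moreover have "\<phi> ` K \<subseteq> \<Omega>" using K assms(2) by blast
    moreover have "holomorphic_nhd \<Omega> f (\<phi> ` K) \<epsilon> \<subseteq> {f \<in> holomorphic_functions \<Omega>. ?C f \<in> U}"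
    proof
      fix g assume g: "g \<in> holomorphic_nhd \<Omega> f (\<phi> ` K) \<epsilon>"
      then have "?C g \<in> holomorphic_nhd \<Omega> (?C f) K \<epsilon>"
        using C K(2) unfolding holomorphic_nhd_def by (auto simp: composition_operator_def subset_iff)
      then show "g \<in> {f \<in> holomorphic_functions \<Omega>. ?C f \<in> U}"
        using g K(4) unfolding holomorphic_nhd_def by blast
    qed
    ultimately show "\<exists>K \<epsilon>. compact K \<and> K \<subseteq> \<Omega> \<and> \<epsilon> > 0 \<and>
        holomorphic_nhd \<Omega> f K \<epsilon> \<subseteq> {f \<in> holomorphic_functions \<Omega>. ?C f \<in> U}"
      using K(3) by blast
  qed auto
  then show ?thesis using C by (simp add: continuous_map_def)
qed

lemma composition_operator_linear:
  assumes "\<phi> ` \<Omega> \<subseteq> \<Omega>"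
  shows "composition_operator \<Omega> \<phi> (\<lambda>z\<in>\<Omega>. a * f z + b * g z) =
           (\<lambda>z\<in>\<Omega>. a * composition_operator \<Omega> \<phi> f z + b * composition_operator \<Omega> \<phi> g z)"
  using assms by (auto simp: composition_operator_def fun_eq_iff)

text \<open>The linear structure of the underlying space plays no role in this condition, so it is
  stated for self-maps of a topological space; \<^term>\<open>T 1\<close> up to \<^term>\<open>T N\<close> are the maps.\<close>

definition disjoint_transitive ::
    "nat set set \<Rightarrow> 'a topology \<Rightarrow> nat \<Rightarrow> (nat \<Rightarrow> 'a \<Rightarrow> 'a) \<Rightarrow> bool" where
  "disjoint_transitive F X N T \<longleftrightarrow>
     (\<forall>U. (\<forall>j\<in>{0..N}. openin X (U j) \<and> U j \<noteq> {}) \<longrightarrow>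
        {n. n \<ge> 1 \<and> U 0 \<inter> (\<Inter>i\<in>{1..N}. {x \<in> topspace X. (T i ^^ n) x \<in> U i}) \<noteq> {}} \<in> F)"

end

theory Submission
  imports Defs "HOL-Complex_Analysis.Complex_Analysis"
begin

text \<open>A compact set \<open>M \<subseteq> \<Omega>\<close> is \<open>\<Omega>\<close>-convex iff no bounded component of \<open>- M\<close> is contained in \<open>\<Omega>\<close>, and by
  Runge's theorem functions holomorphic near such an \<open>M\<close> are uniform limits on \<open>M\<close> of functions in \<open>H(\<Omega>)\<close>.

  If the operators are disjoint transitive, choose \<open>h\<close> small on \<open>K\<close> and near 5 at one point of each of the
  finitely many components of \<open>\<Omega> - K\<close>. When \<open>f \<circ> \<phi>\<^sub>i\<^sub>,\<^sub>n\<close> is close to \<open>h + 10 i\<close> for all \<open>i\<close>, the images of \<open>K\<close>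
  are disjoint, and a hole of one of them inside \<open>\<Omega>\<close> would contradict the maximum principle.

  Conversely, Runge's theorem can be applied on \<open>K \<union> \<phi>\<^sub>1\<^sub>,\<^sub>n(K) \<union> \<dots> \<union> \<phi>\<^sub>N\<^sub>,\<^sub>n(K)\<close> as soon as this union is
  \<open>\<Omega>\<close>-convex. As \<open>\<Omega>\<close> is infinitely connected, \<open>K\<close> can be taken connected with at least \<open>N + 2\<close>
  complementary components, a number that Janiszewski's theorem shows to be preserved by injective holomorphic
  maps. Then some larger \<open>K'\<close> has the property that the union for \<open>K\<close> is \<open>\<Omega>\<close>-convex whenever \<open>n\<close> satisfies
  (2) for \<open>K'\<close>.\<close>

section \<open>Holes and clopen pieces of the complement\<close>

text \<open>The obstacle in the converse is that a union of disjoint \<Omega>-convex sets need not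
  be \<Omega>-convex: one set may surround others that plug its holes, and the region left between
  them may lie in \<Omega>. The remedy is a count. Given such a hole of the union, let
  \<open>C i\<close> be the side of the i-th image on which the hole lies. The images facing the
  hole directly have connected, pairwise disjoint \<open>- C i\<close>. Consider a connected
  \<Omega>-convex set that lies in \<open>C j\<close> and in the j-th image of a larger connected
  set. One of its complementary components may contain image j; every other one swallows some
  \<open>- C i\<close>. With \<open>N + 1\<close> images this leaves at most \<open>N + 1\<close>
  components, so no copy of a set with \<open>N + 2\<close> of them fits there. It remains to
  produce such a copy from images of \<open>K\<close> at different times, and the pigeonhole makes
  the sides comparable between times. Treating \<open>K\<close> as image number 0, under the
  identity, gives all \<open>N + 1\<close> sets the same role. In the direct implication, 5 and the
  spacing 10 are chosen to exceed accumulated errors, which stay below 4.\<close>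

lemma topspace_riemann_sphere [simp]: "topspace riemann_sphere = UNIV"
  by (simp add: riemann_sphere_def UNIV_option_conv)

lemma connectedin_riemann_sphere_image_Some:
  "connectedin riemann_sphere (Some ` C) \<longleftrightarrow> connected C"
proof -
  have emb: "homeomorphic_map euclidean (subtopology riemann_sphere (range Some)) Some"
    using embedding_map_Some[of euclidean] by (simp add: embedding_map_def riemann_sphere_def)
  have "connectedin (subtopology riemann_sphere (range Some)) (Some ` C) \<longleftrightarrow> connectedin euclidean C"
    using homeomorphic_map_connectedness[OF emb] by simp
  then show ?thesis by (auto simp: connectedin_subtopology)
qed

text \<open>A bounded component \<open>C\<close> stays a component in the sphere because it is
  clopen there relative to the complement of \<open>M\<close>: \<open>closure C\<close> is compact,
  hence closed in the sphere, and adds only points of \<open>M\<close>. So no larger connected set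
  can reach infinity from \<open>C\<close>.\<close>

lemma holes_eq_components:
  assumes M: "compact M"
  shows "holes M = {C \<in> components (- M). bounded C}"
proof -
  define X where "X = subtopology riemann_sphere (UNIV - Some ` M)"
  have tX: "topspace X = UNIV - Some ` M" by (simp add: X_def)
  have cin: "connectedin X (Some ` C) \<longleftrightarrow> connected C \<and> C \<subseteq> - M" for C
    by (auto simp: X_def connectedin_subtopology connectedin_riemann_sphere_image_Some)
  have "Some ` C \<in> connected_components_of X" if C: "C \<in> components (- M)" "bounded C" for C
  proof -
    have Cne: "C \<noteq> {}" "connected C" "C \<subseteq> - M" "open C"
      using in_components_nonempty[OF C(1)] in_components_connected[OF C(1)]
        in_components_subset[OF C(1)] open_components[OF _ C(1)] compact_imp_closed[OF M]
      by (auto simp: open_Compl)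
    have "topspace X \<noteq> {}" using tX Cne by auto
    then have "X \<noteq> trivial_topology" by auto
    then obtain D where D: "D \<in> connected_components_of X" "Some ` C \<subseteq> D"
      using exists_connected_component_of_superset[of X "Some ` C"] cin[of C] Cne tX by auto
    have "openin X (Some ` C)"
      using Cne by (auto simp: X_def openin_subtopology riemann_sphere_def intro!: exI[of _ "Some ` C"])
    moreover have "closedin X (Some ` C)"
    proof -
      have "closedin riemann_sphere (Some ` closure C)"
        using C by (simp add: riemann_sphere_def)
      moreover have "Some ` C = Some ` closure C \<inter> (UNIV - Some ` M)"
      proof -
        have "closure C \<subseteq> C \<union> M"
          using frontier_of_components_closed_complement[OF compact_imp_closed[OF M] C(1)]
          by (auto simp: closure_Un_frontier)
        then show ?thesis using Cne closure_subset by fastforce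
      qed
      ultimately show ?thesis unfolding X_def closedin_subtopology by blast
    qed
    moreover have "connectedin X D" using D connectedin_connected_components_of by blast
    moreover have "\<not> disjnt D (Some ` C)" using D(2) Cne(1) unfolding disjnt_def by blast
    ultimately have "D \<subseteq> Some ` C"
      using connectedin_clopen_cases[of X D "Some ` C"] by blast
    then show ?thesis using D by auto
  qed
  moreover have "C \<in> components (- M)" if C: "Some ` C \<in> connected_components_of X" for C
  proof -
    have 1: "connected C" "C \<subseteq> - M" "C \<noteq> {}"
      using C cin connectedin_connected_components_of nonempty_connected_components_of by blast+
    have "C = C'" if "C' \<subseteq> - M" "C \<subseteq> C'" "connected C'" for C'
    proof -
      have "\<not> disjnt (Some ` C) (Some ` C')" using that(2) 1(3) by (auto simp: disjnt_def)
      then have "Some ` C' \<subseteq> Some ` C"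
        using connected_components_of_maximal[OF C, of "Some ` C'"] cin that by blast
      then show ?thesis using that(2) by auto
    qed
    then show ?thesis using 1 unfolding in_components_maximal by blast
  qed
  ultimately show ?thesis
    by (auto simp: holes_def sphere_complement_components_def X_def)
qed

lemma convex_relative_iff:
  "convex_relative \<Omega> M \<longleftrightarrow> compact M \<and> M \<subseteq> \<Omega> \<and> (\<forall>C\<in>components (- M). bounded C \<longrightarrow> \<not> C \<subseteq> \<Omega>)"
  by (auto simp: convex_relative_def holes_eq_components)

text \<open>A finite clopen partition into connected blocks would contain every component as a
  block. With infinitely many components some block is therefore disconnected and can be split in
  two.\<close>

lemma clopen_partition:
  assumes inf: "infinite (connected_components_of X)"
  shows "\<exists>\<A>. finite \<A> \<and> card \<A> = Suc n \<and> \<Union>\<A> = topspace X \<and> disjoint \<A> \<and>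
           (\<forall>A\<in>\<A>. A \<noteq> {} \<and> openin X A \<and> closedin X A)"
proof (induction n)
  case 0
  have "topspace X \<noteq> {}"
    using inf by (metis connected_components_of_eq_empty finite.emptyI null_topspace_iff_trivial)
  then show ?case by (intro exI[of _ "{topspace X}"]) auto
next
  case (Suc n)
  then obtain \<A> where A: "finite \<A>" "card \<A> = Suc n" "\<Union>\<A> = topspace X" "disjoint \<A>"
    "\<And>A. A \<in> \<A> \<Longrightarrow> A \<noteq> {} \<and> openin X A \<and> closedin X A" by blast
  have "\<exists>A\<in>\<A>. \<not> connectedin X A"
  proof (rule ccontr)
    assume neg: "\<not> ?thesis"
    have "connected_components_of X \<subseteq> \<A>"
    proof
      fix C assume C: "C \<in> connected_components_of X"
      then obtain x A0 where x: "x \<in> C" "x \<in> A0" "A0 \<in> \<A>"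
        using nonempty_connected_components_of connected_components_of_subset A(3)
        by (metis UnionE all_not_in_conv subsetD)
      have "A0 \<subseteq> C"
        using connected_components_of_maximal[OF C, of A0] neg x by (auto simp: disjnt_def)
      moreover have "C \<subseteq> A0"
        using connectedin_clopen_cases[OF connectedin_connected_components_of[OF C], of A0] A(5) x
        by (auto simp: disjnt_def)
      ultimately show "C \<in> \<A>" using x by auto
    qed
    then show False using inf A(1) finite_subset by blast
  qed
  then obtain A0 where A0: "A0 \<in> \<A>" "\<not> connectedin X A0" by blast
  have clA0: "openin X A0" "closedin X A0" using A(5) A0 by auto
  then have "A0 \<subseteq> topspace X" using openin_subset by blast
  then have "\<not> connected_space (subtopology X A0)" using A0 by (simp add: connectedin_def)
  then obtain E1 E2 where E: "openin (subtopology X A0) E1" "openin (subtopology X A0) E2"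
    "E1 \<union> E2 = A0" "E1 \<inter> E2 = {}" "E1 \<noteq> {}" "E2 \<noteq> {}"
    using \<open>A0 \<subseteq> topspace X\<close> unfolding connected_space_eq
    by (metis topspace_subtopology_subset)
  have op: "openin X E1" "openin X E2"
    using E(1,2) clA0 openin_trans_full by blast+
  have E2: "E2 = A0 - E1" "E1 = A0 - E2" using E by auto
  then have cl: "closedin X E1" "closedin X E2"
    using op clA0 closedin_diff by metis+
  have other: "B \<inter> A0 = {}" if "B \<in> \<A> - {A0}" for B
    using A(4) A0(1) that unfolding disjoint_def by blast
  have "E1 \<subseteq> A0" "E2 \<subseteq> A0" using E by auto
  then have notin: "E1 \<notin> \<A> - {A0}" "E2 \<notin> \<A> - {A0}" "E1 \<noteq> E2"
    using other[of E1] other[of E2] E(4-6) by auto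
  let ?B = "insert E1 (insert E2 (\<A> - {A0}))"
  have "card ?B = Suc (Suc n)" using notin A(1,2) A0(1) by (simp add: card_Diff_singleton)
  moreover have "\<Union>?B = topspace X" using A(3) A0(1) E(3) by auto
  moreover have "disjoint ?B"
  proof -
    have "B \<inter> E1 = {}" "B \<inter> E2 = {}" if "B \<in> \<A> - {A0}" for B
      using other[OF that] \<open>E1 \<subseteq> A0\<close> \<open>E2 \<subseteq> A0\<close> by auto
    moreover have "disjoint (\<A> - {A0})" using A(4) unfolding disjoint_def by blast
    ultimately show ?thesis
      using E(4) by (auto simp: pairwise_insert disjnt_def)
  qed
  moreover have "\<forall>A\<in>?B. A \<noteq> {} \<and> openin X A \<and> closedin X A" using E op cl A(5) by auto
  ultimately show ?case using A(1) by (intro exI[of _ ?B]) auto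
qed

text \<open>One piece more than required is taken, and the piece containing infinity is thrown away.
  The others are closed in the sphere and miss infinity, which makes them compact in the
  plane.\<close>

lemma complement_compact_pieces:
  assumes "open \<Omega>" "\<not> finitely_connected \<Omega>"
  obtains \<A> where "finite \<A>" "card \<A> = n" "disjoint \<A>"
    "\<And>A. A \<in> \<A> \<Longrightarrow> compact A \<and> A \<noteq> {} \<and> A \<subseteq> - \<Omega> \<and> closed (- \<Omega> - A)"
proof -
  define S where "S = UNIV - Some ` \<Omega>"
  define X where "X = subtopology riemann_sphere S"
  have inf: "infinite (connected_components_of X)"
    using assms(2) by (simp add: finitely_connected_def sphere_complement_components_def X_def S_def)
  obtain \<A> where A: "finite \<A>" "card \<A> = Suc n" "\<Union>\<A> = topspace X" "disjoint \<A>"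
    "\<And>A. A \<in> \<A> \<Longrightarrow> A \<noteq> {} \<and> openin X A \<and> closedin X A"
    using clopen_partition[OF inf, of n] by blast
  have "closedin riemann_sphere S"
  proof -
    have "openin riemann_sphere (Some ` \<Omega>)" using assms(1) by (simp add: riemann_sphere_def)
    then show ?thesis unfolding S_def closedin_def by (simp add: Diff_Diff_Int)
  qed
  then have clS: "closedin riemann_sphere B" if "closedin X B" for B
    using that by (metis X_def closedin_trans_full)
  have tX: "topspace X = S" by (simp add: X_def)
  then have "None \<in> \<Union>\<A>" using A(3) by (auto simp: S_def)
  then obtain A0 where A0: "A0 \<in> \<A>" "None \<in> A0" by blast
  define \<B> where "\<B> = (\<lambda>A. Some -` A) ` (\<A> - {A0})"
  have SA: "A = Some ` (Some -` A)" if "A \<in> \<A> - {A0}" for A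
  proof -
    have "None \<notin> A" using A(4) A0 that unfolding disjoint_def by blast
    then show ?thesis by (auto simp: image_iff) (metis option.exhaust)
  qed
  have "inj_on (\<lambda>A. Some -` A) (\<A> - {A0})" by (metis (no_types, lifting) SA inj_onI)
  then have "card \<B> = n" using A(1,2) A0 by (simp add: \<B>_def card_image)
  moreover have "disjoint \<B>" using A(4) unfolding \<B>_def disjoint_def by fastforce
  moreover have "compact B \<and> B \<noteq> {} \<and> B \<subseteq> - \<Omega> \<and> closed (- \<Omega> - B)" if B: "B \<in> \<B>" for B
  proof -
    obtain A1 where A1: "A1 \<in> \<A> - {A0}" "B = Some -` A1" using B by (auto simp: \<B>_def)
    have S1: "A1 = Some ` B" using SA A1 by blast
    have cl: "closedin X A1" "openin X A1" "A1 \<noteq> {}" using A(5) A1 by auto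
    then have "closedin riemann_sphere (Some ` B)" using clS S1 by simp
    then have "compact B" by (simp add: riemann_sphere_def)
    moreover have "B \<subseteq> - \<Omega>" using closedin_subset[OF cl(1)] tX A1(2) by (auto simp: S_def)
    moreover have "closed (- \<Omega> - B)"
    proof -
      have "closedin riemann_sphere (S - A1)" using clS[of "S - A1"] cl(2) tX
        by (metis closedin_diff closedin_topspace)
      then have "closedin euclidean {x \<in> topspace euclidean. Some x \<in> S - A1}"
        using closedin_continuous_map_preimage[OF continuous_map_Some[of euclidean]]
        unfolding riemann_sphere_def by blast
      moreover have "{x \<in> topspace euclidean. Some x \<in> S - A1} = - \<Omega> - B"
        using A1 by (auto simp: S_def)
      ultimately show ?thesis by simp
    qed
    ultimately show ?thesis using S1 cl by auto
  qed
  moreover have "finite \<B>" using A(1) by (simp add: \<B>_def)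
  ultimately show ?thesis using that by blast
qed

section \<open>Components of planar complements\<close>

text \<open>A connected set joining \<open>x\<close> to \<open>y\<close> off \<open>K\<close> may
  leave \<Omega>, where \<psi> is not controlled. Janiszewski's theorem for \<open>K\<close> and
  \<open>- \<Omega>\<close>, whose intersection is empty and hence connected, replaces it by one
  inside \<open>\<Omega> - K\<close>.\<close>

lemma connected_component_image:
  fixes \<psi> :: "complex \<Rightarrow> complex"
  assumes "open \<Omega>" "connected \<Omega>" "compact K" "K \<subseteq> \<Omega>" "x \<in> \<Omega>" "y \<in> \<Omega>"
    and cont: "continuous_on \<Omega> \<psi>" and inj: "inj_on \<psi> \<Omega>"
    and cc: "connected_component (- K) x y"
  shows "connected_component (- \<psi> ` K) (\<psi> x) (\<psi> y)"
proof -
  have "connected_component (- (- \<Omega>)) x y"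
    using assms by (auto simp: connected_component_def)
  moreover have "K \<inter> - \<Omega> = {}" using assms by auto
  ultimately have "connected_component (- (K \<union> - \<Omega>)) x y"
    using Janiszewski[OF \<open>compact K\<close> _ _ cc, of "- \<Omega>"] assms by (simp add: closed_Compl)
  then obtain T where T: "connected T" "T \<subseteq> \<Omega> - K" "x \<in> T" "y \<in> T"
    by (auto simp: connected_component_def)
  have "connected (\<psi> ` T)"
    using T cont by (meson Diff_subset connected_continuous_image continuous_on_subset order_trans)
  moreover have "\<psi> ` T \<inter> \<psi> ` K = {}"
    using inj_on_image_Int[OF inj, of T K] T assms(4) by auto
  ultimately show ?thesis
    using T unfolding connected_component_def by (intro exI[of _ "\<psi> ` T"]) auto
qed

lemma connected_component_image_iff:
  assumes "open \<Omega>" "connected \<Omega>" "compact K" "K \<subseteq> \<Omega>" "x \<in> \<Omega>" "y \<in> \<Omega>"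
    and holo: "\<psi> holomorphic_on \<Omega>" and inj: "inj_on \<psi> \<Omega>"
  shows "connected_component (- \<psi> ` K) (\<psi> x) (\<psi> y) \<longleftrightarrow> connected_component (- K) x y"
proof
  assume L: "connected_component (- \<psi> ` K) (\<psi> x) (\<psi> y)"
  have cont: "continuous_on \<Omega> \<psi>" using holo holomorphic_on_imp_continuous_on by blast
  obtain g where g: "g holomorphic_on \<psi> ` \<Omega>" "\<And>z. z \<in> \<Omega> \<Longrightarrow> g (\<psi> z) = z"
    using holomorphic_has_inverse[OF holo \<open>open \<Omega>\<close> inj] by metis
  have gi: "g ` \<psi> ` K = K" using g(2) assms(4) by (force simp: image_iff)
  have "connected_component (- g ` \<psi> ` K) (g (\<psi> x)) (g (\<psi> y))"
  proof (rule connected_component_image[OF _ _ _ _ _ _ _ _ L])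
    show "open (\<psi> ` \<Omega>)" using open_mapping_thm3[OF holo \<open>open \<Omega>\<close> inj] .
    show "connected (\<psi> ` \<Omega>)" using connected_continuous_image[OF cont] assms by blast
    show "compact (\<psi> ` K)" using assms cont by (meson compact_continuous_image continuous_on_subset)
    show "continuous_on (\<psi> ` \<Omega>) g" using g holomorphic_on_imp_continuous_on by blast
    show "inj_on g (\<psi> ` \<Omega>)" using g(2) by (auto simp: inj_on_def)
  qed (use assms in auto)
  then show "connected_component (- K) x y" using gi g assms by simp
next
  assume "connected_component (- K) x y"
  then show "connected_component (- \<psi> ` K) (\<psi> x) (\<psi> y)"
    using connected_component_image assms holomorphic_on_imp_continuous_on by blast
qed

text \<open>Janiszewski's theorem, adding one set at a time; the intersection with the earlier union
  is empty and thus connected.\<close>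

lemma connected_component_UN_disjoint:
  fixes K :: "'i \<Rightarrow> complex set"
  assumes "finite I" "\<And>i. i \<in> I \<Longrightarrow> compact (K i)" "disjoint_family_on K I"
    and "\<And>i. i \<in> I \<Longrightarrow> connected_component (- K i) x y"
  shows "connected_component (- (\<Union>i\<in>I. K i)) x y"
  using assms
proof (induction I rule: finite_induct)
  case empty
  then show ?case by (simp add: connected_component_def) (metis UNIV_I connected_UNIV)
next
  case (insert i I)
  have "connected_component (- (\<Union>i\<in>I. K i)) x y"
    using insert by (intro insert.IH) (auto simp: disjoint_family_on_def)
  moreover have "K i \<inter> (\<Union>i\<in>I. K i) = {}"
    using insert by (auto simp: disjoint_family_on_def)
  moreover have "closed (\<Union>i\<in>I. K i)" using insert by (intro closed_UN) (auto intro: compact_imp_closed)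
  ultimately show ?case
    using Janiszewski[of "K i" "\<Union>i\<in>I. K i" x y] insert.prems by simp
qed

text \<open>The frontier of \<open>C\<close> is non-empty and lies in \<open>K\<close>, so \<Omega>
  is a neighbourhood of a point of \<open>closure C\<close>. This provides representatives of
  complementary components at points where the maps are defined.\<close>

lemma component_meets_open:
  fixes K :: "complex set"
  assumes "closed K" "K \<noteq> {}" "K \<subseteq> \<Omega>" "open \<Omega>" and C: "C \<in> components (- K)"
  shows "C \<inter> \<Omega> \<noteq> {}"
proof -
  have "C \<noteq> {}" "C \<noteq> UNIV" using C in_components_nonempty in_components_subset assms(2) by fastforce+
  then obtain p where "p \<in> frontier C" using frontier_eq_empty by blast
  moreover have "frontier C \<subseteq> K" using frontier_of_components_closed_complement[OF assms(1) C] .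
  ultimately have "p \<in> \<Omega> \<inter> closure C" using assms(3) by (auto simp: frontier_def)
  then show ?thesis using open_Int_closure_eq_empty[OF \<open>open \<Omega>\<close>, of C] by blast
qed

section \<open>A closed set together with components of its complement\<close>

lemma connected_Un_component:
  fixes K :: "complex set"
  assumes "closed K" "connected K" "C \<in> components (- K)"
  shows "connected (K \<union> C)"
proof (rule connected_Un_clopen_in_complement[of K UNIV])
  have "open C" using assms open_components[of "- K"] by (simp add: open_Compl)
  then show "openin (top_of_set (UNIV - K)) C"
    using in_components_subset[OF assms(3)] by (metis Compl_eq_Diff_UNIV open_subset)
  show "closedin (top_of_set (UNIV - K)) C"
    using closedin_component[OF assms(3)] by (simp add: Compl_eq_Diff_UNIV)
qed (use assms in auto)

lemma closed_Un_component:
  fixes K :: "complex set"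
  assumes "closed K" "C \<in> components (- K)"
  shows "closed (K \<union> C)"
proof -
  have "closure C \<subseteq> C \<union> K"
    using frontier_of_components_closed_complement[OF assms] by (auto simp: closure_Un_frontier)
  then have "K \<union> closure C = K \<union> C" using closure_subset by blast
  then show ?thesis by (metis assms(1) closed_Un closed_closure)
qed

lemma component_image:
  assumes holo: "\<psi> holomorphic_on \<Omega>" and "open \<Omega>" and inj: "inj_on \<psi> \<Omega>"
    and c: "compact c" "c \<subseteq> \<Omega>" and Y: "Y \<in> components (- c)" "bounded Y" "Y \<subseteq> \<Omega>"
  shows "\<psi> ` Y \<in> components (- \<psi> ` c)" "bounded (\<psi> ` Y)"
proof -
  have cont: "continuous_on \<Omega> \<psi>" using holo holomorphic_on_imp_continuous_on by blast
  have Y1: "open Y" "connected Y" "Y \<noteq> {}" "Y \<inter> c = {}"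
    using Y(1) c(1) in_components_nonempty in_components_connected in_components_subset
      open_components compact_imp_closed open_Compl by (blast+)
  have "compact (c \<union> Y)"
    using closed_Un_component[OF compact_imp_closed[OF c(1)] Y(1)] Y(2) compact_imp_bounded[OF c(1)]
    by (simp add: compact_eq_bounded_closed)
  then have comp: "compact (\<psi> ` (c \<union> Y))"
    using cont c(2) Y(3) by (metis Un_subset_iff compact_continuous_image continuous_on_subset)
  then show "bounded (\<psi> ` Y)"
    using compact_imp_bounded bounded_subset by (metis Un_upper2 image_mono)
  have op: "open (\<psi> ` Y)"
    using open_mapping_thm3[of \<psi> Y] holo Y(3) Y1(1) inj holomorphic_on_subset inj_on_subset by blast
  have conn: "connected (\<psi> ` Y)"
    using Y1(2) cont Y(3) connected_continuous_image continuous_on_subset by blast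
  have sub: "\<psi> ` Y \<subseteq> - \<psi> ` c"
    using inj_on_image_Int[OF inj Y(3) c(2)] Y1(4) by auto
  show "\<psi> ` Y \<in> components (- \<psi> ` c)"
    unfolding in_components_maximal
  proof (intro conjI allI impI)
    fix D assume D: "D \<noteq> {} \<and> \<psi> ` Y \<subseteq> D \<and> D \<subseteq> - \<psi> ` c \<and> connected D"
    have "openin (top_of_set D) (\<psi> ` Y)" using op D by (simp add: open_subset)
    moreover have "closedin (top_of_set D) (\<psi> ` Y)"
    proof -
      have "\<psi> ` Y = D \<inter> \<psi> ` (c \<union> Y)" using D by auto
      then show ?thesis using comp compact_imp_closed by (metis closedin_closed_Int)
    qed
    ultimately show "D = \<psi> ` Y" using D Y1(3) connected_clopen[of D] by blast
  qed (use Y1 conn sub in auto)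
qed

lemma convex_relative_if_image:
  assumes holo: "\<psi> holomorphic_on \<Omega>" and "open \<Omega>" and inj: "inj_on \<psi> \<Omega>" and im: "\<psi> ` \<Omega> \<subseteq> \<Omega>"
    and c: "compact c" "c \<subseteq> \<Omega>" and cvx: "convex_relative \<Omega> (\<psi> ` c)"
  shows "convex_relative \<Omega> c"
  unfolding convex_relative_iff
proof (intro conjI ballI impI notI)
  fix Y assume Y: "Y \<in> components (- c)" "bounded Y" "Y \<subseteq> \<Omega>"
  have "\<psi> ` Y \<in> components (- \<psi> ` c)" "bounded (\<psi> ` Y)" "\<psi> ` Y \<subseteq> \<Omega>"
    using component_image[OF holo \<open>open \<Omega>\<close> inj c Y] Y im by auto
  then show False using cvx unfolding convex_relative_iff by blast
qed (use c in auto)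

text \<open>A hole of \<open>\<psi>\<close> c\<open>filled by \<Omega> might leave the range of
  \<psi>, so it cannot be pulled back at once. The larger
  set\<close>L\<open>prevents this: a point of the hole off\<close>\<psi> \<open>L\<close> would lie
  in a hole of \<open>\<psi>\<close> L\<open>filled by \<Omega>. Inside\<close>\<psi>
  \<open>L\<close> the inverse map carries the hole to a forbidden hole of \<open>c\<close>.\<close>

lemma convex_relative_image_subset:
  assumes holo: "\<psi> holomorphic_on \<Omega>" and "open \<Omega>" and inj: "inj_on \<psi> \<Omega>"
    and c: "convex_relative \<Omega> c" and cL: "c \<subseteq> L" and L: "L \<subseteq> \<Omega>" "convex_relative \<Omega> (\<psi> ` L)"
  shows "convex_relative \<Omega> (\<psi> ` c)"
  unfolding convex_relative_iff
proof (intro conjI ballI impI notI)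
  have cc: "compact c" "c \<subseteq> \<Omega>" using c by (auto simp: convex_relative_iff)
  have cont: "continuous_on \<Omega> \<psi>" using holo holomorphic_on_imp_continuous_on by blast
  show comp: "compact (\<psi> ` c)" using cc cont by (meson compact_continuous_image continuous_on_subset)
  show "\<psi> ` c \<subseteq> \<Omega>" using L cL by (auto simp: convex_relative_iff)
  fix Y assume Y: "Y \<in> components (- \<psi> ` c)" "bounded Y" "Y \<subseteq> \<Omega>"
  obtain g where g: "g holomorphic_on \<psi> ` \<Omega>" "\<And>z. z \<in> \<Omega> \<Longrightarrow> g (\<psi> z) = z"
    using holomorphic_has_inverse[OF holo \<open>open \<Omega>\<close> inj] by metis
  have "Y \<subseteq> \<psi> ` L"
  proof (rule ccontr)
    assume "\<not> Y \<subseteq> \<psi> ` L"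
    then obtain y where y: "y \<in> Y" "y \<in> - \<psi> ` L" by blast
    define D where "D = connected_component_set (- \<psi> ` L) y"
    have D: "D \<in> components (- \<psi> ` L)" using y by (simp add: D_def componentsI)
    have "D \<subseteq> Y"
    proof (rule components_maximal[OF Y(1)])
      show "connected D" using D in_components_connected by blast
      show "D \<subseteq> - \<psi> ` c" using in_components_subset[OF D] cL by blast
      show "Y \<inter> D \<noteq> {}" using y by (auto simp: D_def)
    qed
    moreover have "bounded D" using \<open>D \<subseteq> Y\<close> Y(2) bounded_subset by blast
    ultimately show False using D L(2) Y(3) unfolding convex_relative_iff by blast
  qed
  then have Y3: "Y \<subseteq> \<psi> ` \<Omega>" using L by blast
  have gi: "g ` \<psi> ` c = c" using g(2) cc by (force simp: image_iff)
  have "g ` Y \<in> components (- g ` \<psi> ` c) \<and> bounded (g ` Y)"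
    using component_image[OF g(1) _ _ comp _ Y(1,2) Y3] open_mapping_thm3[OF holo \<open>open \<Omega>\<close> inj] g(2) cc
    by (auto simp: inj_on_def)
  moreover have "g ` Y \<subseteq> \<Omega>" using Y3 g(2) by auto
  ultimately show False using c gi unfolding convex_relative_iff by metis
qed

lemma finite_components_convex_relative:
  assumes c: "convex_relative \<Omega> K" and "open \<Omega>"
  shows "finite (components (- K))"
proof -
  have K: "compact K" using c by (simp add: convex_relative_iff)
  then obtain r where r: "K \<subseteq> cball 0 r" "r > 0"
    using bounded_subset_ballD[OF compact_imp_bounded, of K 0] ball_subset_cball by blast
  \<comment> \<open>A compact subset of \<open>- K\<close> that meets every component: a bounded
    component contains a point outside \<Omega>, and the unbounded one contains the circle of radius
    \<open>r + 1\<close>. The components form an open cover of \<open>E\<close> by disjoint sets, so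
    a finite subcover already lists them all.\<close>
  define E where "E = (cball 0 (r + 1) - \<Omega>) \<union> sphere 0 (r + 1)"
  have "compact E" using \<open>open \<Omega>\<close> by (simp add: compact_diff compact_Un E_def)
  moreover have "E \<subseteq> \<Union>(components (- K))"
    using c r by (auto simp: E_def convex_relative_iff)
  ultimately obtain \<C> where C: "\<C> \<subseteq> components (- K)" "finite \<C>" "E \<subseteq> \<Union>\<C>"
    using compactE[of E "components (- K)"] open_components K by (metis compact_imp_closed open_Compl)
  have "components (- K) \<subseteq> \<C>"
  proof
    fix C assume C': "C \<in> components (- K)"
    have "C \<inter> E \<noteq> {}"
    proof (cases "C \<subseteq> cball 0 r")
      case True
      then have "bounded C" using bounded_subset[OF bounded_cball] by blast
      then have "\<not> C \<subseteq> \<Omega>" using c C' unfolding convex_relative_iff by blast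
      then obtain z where "z \<in> C" "z \<notin> \<Omega>" by blast
      then show ?thesis using True by (force simp: E_def)
    next
      case False
      then obtain p where p: "p \<in> C" "p \<notin> cball 0 r" by blast
      have "connected (- cball 0 r :: complex set)"
        by (rule connected_complement_bounded_convex) auto
      then have "- cball 0 r \<subseteq> C"
        using components_maximal[OF C', of "- cball 0 r"] r p by blast
      moreover have "complex_of_real (r + 1) \<in> - cball 0 r" "complex_of_real (r + 1) \<in> sphere 0 (r + 1)"
        using r by (auto simp: norm_of_real simp del: of_real_add)
      ultimately show ?thesis unfolding E_def by blast
    qed
    then obtain z C'' where "z \<in> C" "z \<in> C''" "C'' \<in> \<C>" using C(3) by blast
    then show "C \<in> \<C>" using C(1) C' by (metis Int_iff components_eq empty_iff subsetD)
  qed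
  then show ?thesis using C(2) finite_subset by blast
qed

section \<open>Connected \<Omega>-convex hulls\<close>

lemma compact_connected_superset:
  fixes \<Omega> :: "complex set"
  assumes "open \<Omega>" "connected \<Omega>" "\<Omega> \<noteq> {}" "compact L" "L \<subseteq> \<Omega>"
  obtains K where "compact K" "connected K" "K \<noteq> {}" "L \<subseteq> K" "K \<subseteq> \<Omega>"
proof -
  obtain a where a: "a \<in> \<Omega>" using assms by blast
  have "\<exists>T. compact T \<and> connected T \<and> a \<in> T \<and> T \<subseteq> \<Omega> \<and> x \<in> interior T" if x: "x \<in> \<Omega>" for x
  proof -
    obtain r where r: "r > 0" "cball x r \<subseteq> \<Omega>" using x assms(1) by (metis open_contains_cball)
    obtain g where g: "path g" "path_image g \<subseteq> \<Omega>" "pathstart g = a" "pathfinish g = x"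
      using connected_open_path_connected[OF assms(1,2)] a x unfolding path_connected_def by metis
    have "connected (path_image g \<union> cball x r)"
    proof (rule connected_Un)
      have "x \<in> path_image g" using g pathfinish_in_path_image by blast
      then show "path_image g \<inter> cball x r \<noteq> {}" using r by auto
    qed (use g connected_path_image in auto)
    moreover have "compact (path_image g \<union> cball x r)"
      using g by (simp add: compact_Un compact_path_image)
    moreover have "x \<in> interior (path_image g \<union> cball x r)"
      using r by (meson ball_subset_cball centre_in_ball interiorI open_ball sup.coboundedI2)
    moreover have "a \<in> path_image g" using g pathstart_in_path_image by blast
    ultimately show ?thesis using g r by (intro exI[of _ "path_image g \<union> cball x r"]) auto
  qed
  then obtain T where T: "\<And>x. x \<in> \<Omega> \<Longrightarrow> compact (T x) \<and> connected (T x) \<and> a \<in> T x \<and> T x \<subseteq> \<Omega> \<and> x \<in> interior (T x)"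
    by metis
  obtain S where S: "S \<subseteq> L" "finite S" "L \<subseteq> (\<Union>x\<in>S. interior (T x))"
    using compactE_image[OF \<open>compact L\<close>, of L "\<lambda>x. interior (T x)"] T assms(5) by blast
  \<comment> \<open>Every \<open>T x\<close> contains \<open>a\<close>, which connects the union.
    The explicit \<open>{a}\<close> covers the case where \<open>L\<close> is empty.\<close>
  define K where "K = {a} \<union> (\<Union>x\<in>S. T x)"
  have ST: "compact (T x)" "connected (T x)" "a \<in> T x" "T x \<subseteq> \<Omega>" if "x \<in> S" for x
    using T that S assms(5) by blast+
  have "compact K" unfolding K_def using ST S by (intro compact_Un compact_UN) auto
  moreover have "K = \<Union>(insert {a} (T ` S))" by (auto simp: K_def)
  then have "connected K" using ST by (simp only:) (rule connected_Union, auto)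
  moreover have "L \<subseteq> K" using S(3) interior_subset by (fastforce simp: K_def)
  moreover have "K \<subseteq> \<Omega>" using ST(4) a unfolding K_def by blast
  ultimately show ?thesis using that[of K] by (auto simp: K_def)
qed

text \<open>The bounded complementary components contained in \<Omega> are filled in. Each is
  attached to the connected set \<open>M\<close>, so connectedness survives. A forbidden hole of the
  result would contain a component of \<open>- M\<close> that should have been filled.\<close>

lemma convex_relative_hull:
  assumes "open \<Omega>" "connected \<Omega>" "\<Omega> \<noteq> {}" "compact L" "L \<subseteq> \<Omega>"
  obtains K where "convex_relative \<Omega> K" "connected K" "K \<noteq> {}" "L \<subseteq> K"
proof -
  obtain M where M: "compact M" "connected M" "M \<noteq> {}" "L \<subseteq> M" "M \<subseteq> \<Omega>"
    using compact_connected_superset[OF assms] by metis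
  have clM: "closed M" using M compact_imp_closed by blast
  define H where "H = {C \<in> components (- M). bounded C \<and> C \<subseteq> \<Omega>}"
  define K where "K = M \<union> \<Union>H"
  have Kc: "- K = \<Union>(components (- M) - H)"
  proof -
    have "- M = \<Union>(components (- M))" by simp
    moreover have "\<Union>(components (- M) - H) \<inter> \<Union>H = {}"
      using components_eq[of _ "- M"] by (fastforce simp: H_def)
    moreover have "H \<subseteq> components (- M)" by (auto simp: H_def)
    ultimately show ?thesis unfolding K_def by blast
  qed
  have "open (- K)" unfolding Kc using clM open_components[of "- M"] by (auto simp: open_Compl)
  then have "closed K" by (simp add: closed_def)
  moreover have "bounded K"
  proof -
    obtain r where r: "M \<subseteq> cball 0 r"
      using bounded_subset_ballD[OF compact_imp_bounded[OF M(1)], of 0] ball_subset_cball by blast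
    have "C \<subseteq> cball 0 r" if C: "C \<in> components (- M)" "bounded C" for C
    proof (rule ccontr)
      assume "\<not> C \<subseteq> cball 0 r"
      moreover have "connected (- cball 0 r :: complex set)"
        by (rule connected_complement_bounded_convex) auto
      ultimately have "- cball 0 r \<subseteq> C"
        using components_maximal[OF C(1), of "- cball 0 r"] r by blast
      then have "bounded (- cball 0 r :: complex set)" using bounded_subset[OF C(2)] by blast
      then show False using bounded_cball cobounded_imp_unbounded by blast
    qed
    then have "K \<subseteq> cball 0 r" using r by (auto simp: K_def H_def)
    then show ?thesis using bounded_subset[OF bounded_cball] by blast
  qed
  ultimately have "compact K" by (simp add: compact_eq_bounded_closed)
  moreover have "connected K"
  proof -
    have "K = \<Union>(insert M ((\<lambda>C. M \<union> C) ` H))" by (auto simp: K_def)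
    moreover have "connected \<dots>"
      using M connected_Un_component[OF clM M(2)] by (intro connected_Union) (auto simp: H_def)
    ultimately show ?thesis by simp
  qed
  moreover have "\<not> C \<subseteq> \<Omega>" if C: "C \<in> components (- K)" "bounded C" for C
  proof -
    obtain z where z: "z \<in> C" using in_components_nonempty[OF C(1)] by blast
    then have "z \<in> - K" using in_components_subset[OF C(1)] by blast
    then obtain D where D: "D \<in> components (- M)" "D \<notin> H" "z \<in> D" using Kc by blast
    have "D \<subseteq> C"
      using components_maximal[OF C(1), of D] D z Kc in_components_connected by blast
    then have "D \<subseteq> \<Omega> \<Longrightarrow> D \<in> H" using D(1) bounded_subset[OF C(2)] by (auto simp: H_def)
    then show ?thesis using D \<open>D \<subseteq> C\<close> by blast
  qed
  moreover have "K \<subseteq> \<Omega>" using M by (auto simp: K_def H_def)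
  ultimately have "convex_relative \<Omega> K" by (simp add: convex_relative_iff)
  then show ?thesis using that[of K] M \<open>connected K\<close> by (auto simp: K_def)
qed

section \<open>Runge's theorem\<close>

text \<open>Membership in the uniform closure of the holomorphic functions on \<open>M\<close>.
  Nothing is asked of \<open>f\<close> off \<open>M\<close>, so kernels with poles, Cauchy integrals
  and piecewise functions all qualify as candidates.\<close>

definition approximable :: "complex set \<Rightarrow> complex set \<Rightarrow> (complex \<Rightarrow> complex) \<Rightarrow> bool" where
  "approximable \<Omega> M f \<longleftrightarrow> (\<forall>\<epsilon>>0. \<exists>h. h holomorphic_on \<Omega> \<and> (\<forall>z\<in>M. norm (h z - f z) < \<epsilon>))"

lemma approximable_holomorphic: "h holomorphic_on \<Omega> \<Longrightarrow> approximable \<Omega> M h"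
  by (force simp: approximable_def)

lemma approximable_cong:
  "(\<And>z. z \<in> M \<Longrightarrow> f z = g z) \<Longrightarrow> approximable \<Omega> M f \<longleftrightarrow> approximable \<Omega> M g"
  by (simp add: approximable_def)

lemma approximable_limit:
  assumes "\<And>\<epsilon>. \<epsilon> > 0 \<Longrightarrow> \<exists>g. approximable \<Omega> M g \<and> (\<forall>z\<in>M. norm (g z - f z) < \<epsilon>)"
  shows "approximable \<Omega> M f"
  unfolding approximable_def
proof (intro allI impI)
  fix \<epsilon> :: real assume "\<epsilon> > 0"
  then obtain g where g: "approximable \<Omega> M g" "\<forall>z\<in>M. norm (g z - f z) < \<epsilon>/2"
    using assms[of "\<epsilon>/2"] by auto
  then obtain h where h: "h holomorphic_on \<Omega>" "\<forall>z\<in>M. norm (h z - g z) < \<epsilon>/2"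
    using \<open>\<epsilon> > 0\<close> unfolding approximable_def by (meson half_gt_zero)
  have "norm (h z - f z) < \<epsilon>" if "z \<in> M" for z
    using norm_triangle_ineq[of "h z - g z" "g z - f z"] g(2) h(2) that by fastforce
  then show "\<exists>h. h holomorphic_on \<Omega> \<and> (\<forall>z\<in>M. norm (h z - f z) < \<epsilon>)" using h(1) by blast
qed

lemma approximable_add:
  assumes "approximable \<Omega> M f" "approximable \<Omega> M g"
  shows "approximable \<Omega> M (\<lambda>z. f z + g z)"
  unfolding approximable_def
proof (intro allI impI)
  fix \<epsilon> :: real assume "\<epsilon> > 0"
  then obtain h k where h: "h holomorphic_on \<Omega>" "\<forall>z\<in>M. norm (h z - f z) < \<epsilon>/2"
    "k holomorphic_on \<Omega>" "\<forall>z\<in>M. norm (k z - g z) < \<epsilon>/2"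
    using assms unfolding approximable_def by (meson half_gt_zero)
  have "norm ((h z + k z) - (f z + g z)) < \<epsilon>" if "z \<in> M" for z
    using norm_triangle_ineq[of "h z - f z" "k z - g z"] h that by (fastforce simp: algebra_simps)
  then show "\<exists>h. h holomorphic_on \<Omega> \<and> (\<forall>z\<in>M. norm (h z - (f z + g z)) < \<epsilon>)"
    using h by (intro exI[of _ "\<lambda>z. h z + k z"]) (auto intro: holomorphic_intros)
qed

lemma approximable_bounded:
  assumes "approximable \<Omega> M f" "compact M" "M \<subseteq> \<Omega>"
  obtains B where "B > 0" "\<And>z. z \<in> M \<Longrightarrow> norm (f z) \<le> B"
proof -
  obtain h where h: "h holomorphic_on \<Omega>" "\<forall>z\<in>M. norm (h z - f z) < 1"
    using assms(1) unfolding approximable_def by (meson zero_less_one)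
  have "compact (h ` M)"
    using h(1) assms by (meson compact_continuous_image continuous_on_subset holomorphic_on_imp_continuous_on)
  then obtain B where B: "B > 0" "\<And>z. z \<in> M \<Longrightarrow> norm (h z) \<le> B"
    by (metis bounded_pos compact_imp_bounded imageI)
  have "norm (f z) \<le> B + 1" if "z \<in> M" for z
    using norm_triangle_ineq3[of "f z" "h z"] h(2) B(2) that by (fastforce simp: norm_minus_commute)
  then show ?thesis using that[of "B + 1"] B(1) by auto
qed

lemma approximable_mult:
  assumes f: "approximable \<Omega> M f" and g: "approximable \<Omega> M g" and M: "compact M" "M \<subseteq> \<Omega>"
  shows "approximable \<Omega> M (\<lambda>z. f z * g z)"
  unfolding approximable_def
proof (intro allI impI)
  fix \<epsilon> :: real assume e: "\<epsilon> > 0"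
  obtain B where B: "B > 0" "\<And>z. z \<in> M \<Longrightarrow> norm (g z) \<le> B" using approximable_bounded[OF g M] by blast
  obtain h where h: "h holomorphic_on \<Omega>" "\<forall>z\<in>M. norm (h z - f z) < \<epsilon>/(2*B)"
    using f divide_pos_pos[OF e, of "2*B"] B(1) unfolding approximable_def by force
  obtain C where C: "C > 0" "\<And>z. z \<in> M \<Longrightarrow> norm (h z) \<le> C"
    using approximable_bounded[OF approximable_holomorphic[OF h(1)] M] by blast
  obtain k where k: "k holomorphic_on \<Omega>" "\<forall>z\<in>M. norm (k z - g z) < \<epsilon>/(2*C)"
    using g divide_pos_pos[OF e, of "2*C"] C(1) unfolding approximable_def by force
  have "norm (h z * k z - f z * g z) < \<epsilon>" if z: "z \<in> M" for z
  proof -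
    have "h z * k z - f z * g z = h z * (k z - g z) + (h z - f z) * g z" by (simp add: algebra_simps)
    then have "norm (h z * k z - f z * g z) \<le> norm (h z) * norm (k z - g z) + norm (h z - f z) * norm (g z)"
      by (metis norm_mult norm_triangle_ineq)
    also have "\<dots> \<le> C * norm (k z - g z) + norm (h z - f z) * B"
      using B C z by (intro add_mono mult_mono) (auto simp: less_imp_le)
    also have "\<dots> < C * (\<epsilon>/(2*C)) + \<epsilon>/(2*B) * B"
      using h(2) k(2) z B(1) C(1) by (intro add_strict_mono mult_strict_left_mono mult_strict_right_mono) auto
    also have "\<dots> = \<epsilon>" using B(1) C(1) by (simp add: field_simps)
    finally show ?thesis .
  qed
  then show "\<exists>h. h holomorphic_on \<Omega> \<and> (\<forall>z\<in>M. norm (h z - f z * g z) < \<epsilon>)"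
    using h k by (intro exI[of _ "\<lambda>z. h z * k z"]) (auto intro: holomorphic_intros)
qed

lemma approximable_cmult:
  assumes "approximable \<Omega> M f" "compact M" "M \<subseteq> \<Omega>"
  shows "approximable \<Omega> M (\<lambda>z. c * f z)"
  using approximable_mult[OF approximable_holomorphic[of "\<lambda>_. c"] assms] by simp

lemma approximable_sum:
  assumes "finite I" "\<And>i. i \<in> I \<Longrightarrow> approximable \<Omega> M (f i)"
  shows "approximable \<Omega> M (\<lambda>z. \<Sum>i\<in>I. f i z)"
  using assms by (induction I rule: finite_induct) (auto intro: approximable_add approximable_holomorphic)

lemma approximable_power:
  assumes "approximable \<Omega> M f" "compact M" "M \<subseteq> \<Omega>"
  shows "approximable \<Omega> M (\<lambda>z. f z ^ n)"
  by (induction n) (simp_all add: approximable_holomorphic approximable_mult assms)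

text \<open>Partial sums of the geometric series converge uniformly on \<open>M\<close>. Both ways
  of moving a pole are instances: \<open>q = (b - a) / (z - a)\<close> moves it from
  \<open>a\<close> to \<open>b\<close>, and \<open>q = z / a\<close> expands a kernel with a distant
  pole.\<close>

lemma approximable_geometric:
  assumes u: "approximable \<Omega> M u" and q: "approximable \<Omega> M q" and M: "compact M" "M \<subseteq> \<Omega>"
    and small: "\<And>z. z \<in> M \<Longrightarrow> norm (q z) \<le> 1/2"
  shows "approximable \<Omega> M (\<lambda>z. u z / (1 - q z))"
proof (rule approximable_limit)
  fix \<epsilon> :: real assume e: "\<epsilon> > 0"
  obtain B where B: "B > 0" "\<And>z. z \<in> M \<Longrightarrow> norm (u z) \<le> B" using approximable_bounded[OF u M] by blast
  \<comment> \<open>The remainder is at most \<open>B * (1/2) ^ n\<close> divided by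
    \<open>1/2\<close>, the lower bound for \<open>norm (1 - q z)\<close>; hence the factor
    2.\<close>
  obtain n where n: "(1/2::real) ^ n < \<epsilon> / (2 * B)"
    using real_arch_pow_inv[of "\<epsilon> / (2 * B)" "1/2"] e B by auto
  have "norm (u z * (\<Sum>k<n. q z ^ k) - u z / (1 - q z)) < \<epsilon>" if z: "z \<in> M" for z
  proof -
    have q1: "q z \<noteq> 1" using small[OF z] by auto
    have "1/2 \<le> norm (1 - q z)" using norm_triangle_ineq2[of 1 "q z"] small[OF z] by simp
    have "u z * (\<Sum>k<n. q z ^ k) - u z / (1 - q z) = - (u z * q z ^ n / (1 - q z))"
      using q1 by (simp add: sum_gp_strict diff_divide_distrib right_diff_distrib)
    then have "norm (u z * (\<Sum>k<n. q z ^ k) - u z / (1 - q z)) = norm (u z) * norm (q z) ^ n / norm (1 - q z)"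
      by (simp add: norm_mult norm_divide norm_power)
    also have "\<dots> \<le> B * (1/2) ^ n / (1/2)"
      using B z small[OF z] \<open>1/2 \<le> norm (1 - q z)\<close>
      by (intro frac_le mult_mono power_mono) (auto simp: less_imp_le)
    also have "\<dots> < \<epsilon>" using n B(1) by (simp add: field_simps)
    finally show ?thesis .
  qed
  moreover have "approximable \<Omega> M (\<lambda>z. u z * (\<Sum>k<n. q z ^ k))"
    using u q M by (intro approximable_mult approximable_sum approximable_power) auto
  ultimately show "\<exists>g. approximable \<Omega> M g \<and> (\<forall>z\<in>M. norm (g z - u z / (1 - q z)) < \<epsilon>)" by blast
qed

section \<open>Moving poles within a component of the complement\<close>

lemma approximable_pole_step:
  assumes "approximable \<Omega> M (\<lambda>z. 1 / (z - a))" and M: "compact M" "M \<subseteq> \<Omega>"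
    and far: "\<And>z. z \<in> M \<Longrightarrow> 2 * norm (b - a) \<le> norm (z - a)" and ab: "a \<notin> M" "b \<notin> M"
  shows "approximable \<Omega> M (\<lambda>z. 1 / (z - b))"
proof -
  have "approximable \<Omega> M (\<lambda>z. (1 / (z - a)) / (1 - (b - a) * (1 / (z - a))))"
  proof (rule approximable_geometric[OF assms(1) _ M])
    show "approximable \<Omega> M (\<lambda>z. (b - a) * (1 / (z - a)))"
      using approximable_cmult[OF assms(1) M] .
    fix z assume z: "z \<in> M"
    then have "z \<noteq> a" using ab by auto
    then show "norm ((b - a) * (1 / (z - a))) \<le> 1/2"
      using far[OF z] by (simp add: norm_mult norm_divide field_simps)
  qed
  moreover have "(1 / (z - a)) / (1 - (b - a) * (1 / (z - a))) = 1 / (z - b)" if "z \<in> M" for z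
  proof -
    have "z \<noteq> a" "z \<noteq> b" using ab that by auto
    then show ?thesis by (simp add: field_simps)
  qed
  ultimately show ?thesis using approximable_cong by (metis (no_types, lifting))
qed

lemma approximable_pole_far:
  assumes M: "compact M" "M \<subseteq> \<Omega>" and far: "\<And>z. z \<in> M \<Longrightarrow> 2 * norm z \<le> norm a" and "a \<noteq> 0"
  shows "approximable \<Omega> M (\<lambda>z. 1 / (z - a))"
proof -
  have "approximable \<Omega> M (\<lambda>z. (- 1 / a) / (1 - z / a))"
    using far \<open>a \<noteq> 0\<close>
    by (intro approximable_geometric M approximable_holomorphic holomorphic_intros)
       (auto simp: norm_divide field_simps)
  moreover have "(- 1 / a) / (1 - z / a) = 1 / (z - a)" if "z \<in> M" for z
  proof -
    have "z \<noteq> a"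
    proof
      assume "z = a"
      then have "2 * norm a \<le> norm a" using far[OF that] by simp
      then show False using \<open>a \<noteq> 0\<close> by simp
    qed
    then show ?thesis using \<open>a \<noteq> 0\<close> by (simp add: field_simps)
  qed
  ultimately show ?thesis using approximable_cong by (metis (no_types, lifting))
qed

text \<open>Approximability of the kernel is locally constant in the pole, hence constant on each
  component \<open>C\<close> of \<open>- M\<close>. A suitable pole in \<open>C\<close> always
  exists: a point outside \<Omega>, where the kernel is holomorphic on \<Omega>, or else, since
  \<Omega>-convexity makes \<open>C\<close> unbounded, a point far from \<open>M\<close>.\<close>

lemma approximable_pole:
  assumes M: "convex_relative \<Omega> M" and a: "a \<notin> M"
  shows "approximable \<Omega> M (\<lambda>z. 1 / (z - a))"
proof (cases "M = {}")
  case True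
  then show ?thesis by (auto simp: approximable_def intro!: exI[of _ "\<lambda>_. 0"])
next
  case False
  have M1: "compact M" "M \<subseteq> \<Omega>" using M by (auto simp: convex_relative_iff)
  define C where "C = connected_component_set (- M) a"
  have C: "C \<in> components (- M)" "a \<in> C" using a by (auto simp: C_def componentsI)
  have Csub: "C \<subseteq> - M" using in_components_subset[OF C(1)] .
  have conn: "approximable \<Omega> M (\<lambda>z. 1 / (z - x)) \<longleftrightarrow> approximable \<Omega> M (\<lambda>z. 1 / (z - y))"
    if xy: "x \<in> C" "y \<in> C" for x y
  proof (rule connected_equivalence_relation[OF in_components_connected[OF C(1)] xy])
    fix p assume p: "p \<in> C"
    define d where "d = infdist p M"
    have pM: "p \<notin> M" using p Csub by blast
    then have d: "d > 0"
      using in_closed_iff_infdist_zero[OF compact_imp_closed[OF M1(1)] False, of p]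
      by (simp add: d_def infdist_nonneg order_less_le)
    have dz: "d \<le> norm (z - p)" if "z \<in> M" for z
      using infdist_le[OF that, of p] by (simp add: d_def dist_norm norm_minus_commute)
    \<comment> \<open>The radius \<open>d / 3\<close> lets the pole move both ways: points of
      \<open>M\<close> have distance at least \<open>d\<close> from \<open>p\<close> and at least
      \<open>2 * d / 3\<close> from \<open>x\<close>, in each case at least twice the
      displacement.\<close>
    have "approximable \<Omega> M (\<lambda>z. 1 / (z - p)) \<longleftrightarrow> approximable \<Omega> M (\<lambda>z. 1 / (z - x))"
      if x: "x \<in> C" "dist p x < d / 3" for x
    proof -
      have xM: "x \<notin> M" using x Csub by blast
      have xp: "norm (x - p) < d / 3" "norm (p - x) < d / 3"
        using x by (auto simp: dist_norm norm_minus_commute)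
      have 1: "2 * norm (x - p) \<le> norm (z - p)" if "z \<in> M" for z
        using dz[OF that] xp(1) d by linarith
      have 2: "2 * norm (p - x) \<le> norm (z - x)" if "z \<in> M" for z
        using dz[OF that] xp d norm_triangle_ineq[of "z - x" "x - p"] by simp
      show ?thesis using approximable_pole_step[OF _ M1] 1 2 xM pM by blast
    qed
    note near = this
    show "\<exists>T. openin (top_of_set C) T \<and> p \<in> T \<and>
        (\<forall>x\<in>T. approximable \<Omega> M (\<lambda>z. 1 / (z - p)) \<longleftrightarrow> approximable \<Omega> M (\<lambda>z. 1 / (z - x)))"
    proof (intro exI[of _ "C \<inter> ball p (d / 3)"] conjI ballI)
      show "openin (top_of_set C) (C \<inter> ball p (d / 3))" by (rule openin_open_Int) simp
      show "p \<in> C \<inter> ball p (d / 3)" using p d by simp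
      fix x assume "x \<in> C \<inter> ball p (d / 3)"
      then have "x \<in> C" "dist p x < d / 3" by simp_all
      then show "approximable \<Omega> M (\<lambda>z. 1 / (z - p)) \<longleftrightarrow> approximable \<Omega> M (\<lambda>z. 1 / (z - x))"
        by (rule near)
    qed
  qed auto
  show ?thesis
  proof (cases "C \<subseteq> \<Omega>")
    case True
    then have unb: "\<not> bounded C" using M C unfolding convex_relative_iff by blast
    obtain r where r: "r > 0" "\<And>z. z \<in> M \<Longrightarrow> norm z \<le> r"
      using compact_imp_bounded[OF M1(1)] by (auto simp: bounded_pos)
    obtain b where b: "b \<in> C" "norm b > 2 * r" using unb by (auto simp: bounded_iff not_le)
    have "approximable \<Omega> M (\<lambda>z. 1 / (z - b))"
      using r b by (intro approximable_pole_far[OF M1]) force+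
    then show ?thesis using conn[OF b(1) C(2)] by blast
  next
    case False
    then obtain e where e: "e \<in> C" "e \<notin> \<Omega>" by blast
    have "(\<lambda>z. 1 / (z - e)) holomorphic_on \<Omega>" using e by (intro holomorphic_intros) auto
    then show ?thesis using conn[OF e(1) C(2)] approximable_holomorphic by blast
  qed
qed

text \<open>Riemann sums of the integral are combinations of kernels with poles off
  \<open>M\<close>. They converge uniformly in \<open>z\<close>, because the integrand is uniformly
  continuous on the compact set \<open>{0..1} \<times> M\<close>.\<close>

lemma approximable_segment_integral:
  assumes M: "convex_relative \<Omega> M" and disj: "closed_segment p q \<inter> M = {}"
    and f: "continuous_on (closed_segment p q) f"
  shows "approximable \<Omega> M (\<lambda>z. contour_integral (linepath p q) (\<lambda>w. f w / (w - z)))"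
proof (rule approximable_limit)
  fix \<epsilon> :: real assume e: "\<epsilon> > 0"
  have M1: "compact M" "M \<subseteq> \<Omega>" using M by (auto simp: convex_relative_iff)
  define g where "g = (\<lambda>t. f (linepath p q t) * (q - p))"
  define k where "k = (\<lambda>t z. g t / (linepath p q t - z))"
  have seg: "linepath p q t \<in> closed_segment p q" if "t \<in> {0..1}" for t
    using that linepath_in_path[of t p q] by simp
  then have ne: "linepath p q t \<noteq> z" if "t \<in> {0..1}" "z \<in> M" for t z using that disj by blast
  have contg: "continuous_on {0..1} g"
    unfolding g_def using seg
    by (intro continuous_intros continuous_on_compose2[OF f]) auto
  have "continuous_on ({0..1} \<times> M) (\<lambda>(t, z). k t z)"
    unfolding k_def case_prod_unfold
    using ne by (intro continuous_intros continuous_on_compose2[OF contg]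
        continuous_on_compose2[OF continuous_on_linepath]) auto
  then have uc: "uniformly_continuous_on ({0..1} \<times> M) (\<lambda>(t, z). k t z)"
    using M1 by (intro compact_uniformly_continuous compact_Times) auto
  obtain d where d: "d > 0" "\<And>t t' z. t \<in> {0..1} \<Longrightarrow> t' \<in> {0..1} \<Longrightarrow> z \<in> M \<Longrightarrow> \<bar>t - t'\<bar> < d \<Longrightarrow>
      norm (k t z - k t' z) < \<epsilon>/2"
  proof -
    obtain d where d: "d > 0" "\<And>x x'. x \<in> {0..1} \<times> M \<Longrightarrow> x' \<in> {0..1} \<times> M \<Longrightarrow> dist x' x < d \<Longrightarrow>
        dist (case x' of (t, z) \<Rightarrow> k t z) (case x of (t, z) \<Rightarrow> k t z) < \<epsilon>/2"
      using uc e unfolding uniformly_continuous_on_def by (meson half_gt_zero)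
    show ?thesis
    proof (rule that[OF d(1)])
      fix t t' z assume "t \<in> {0..1::real}" "t' \<in> {0..1::real}" "z \<in> M" "\<bar>t - t'\<bar> < d"
      then show "norm (k t z - k t' z) < \<epsilon>/2"
        using d(2)[of "(t', z)" "(t, z)"] by (simp add: dist_Pair_Pair dist_norm)
    qed
  qed
  have contk: "continuous_on {0..1} (\<lambda>t. k t z)" if "z \<in> M" for z
    unfolding k_def using ne that by (intro continuous_intros contg) auto
  \<comment> \<open>The error allowance is proportional to \<open>b - a\<close>, so it adds up
    exactly when adjacent intervals are joined. This fits the Bolzano induction, which reduces the
    claim to short intervals.\<close>
  define P where "P = (\<lambda>a b. 0 \<le> a \<and> b \<le> 1 \<longrightarrow>
    (\<exists>r. approximable \<Omega> M r \<and> (\<forall>z\<in>M. norm (r z - integral {a..b} (\<lambda>t. k t z)) \<le> \<epsilon>/2 * (b - a))))"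
  have "P 0 1"
  proof (rule Bolzano)
    fix a b c :: real assume abc: "P a b" "P b c" "a \<le> b" "b \<le> c"
    show "P a c" unfolding P_def
    proof
      assume ac: "0 \<le> a \<and> c \<le> 1"
      obtain r where r: "approximable \<Omega> M r" "\<And>z. z \<in> M \<Longrightarrow> norm (r z - integral {a..b} (\<lambda>t. k t z)) \<le> \<epsilon>/2 * (b - a)"
        using abc ac unfolding P_def by force
      obtain s where s: "approximable \<Omega> M s" "\<And>z. z \<in> M \<Longrightarrow> norm (s z - integral {b..c} (\<lambda>t. k t z)) \<le> \<epsilon>/2 * (c - b)"
        using abc ac unfolding P_def by force
      have "norm ((r z + s z) - integral {a..c} (\<lambda>t. k t z)) \<le> \<epsilon>/2 * (c - a)" if z: "z \<in> M" for z
      proof -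
        have "(\<lambda>t. k t z) integrable_on {a..c}"
          using ac abc continuous_on_subset[OF contk[OF z]] by (intro integrable_continuous_real) auto
        then have eq: "integral {a..c} (\<lambda>t. k t z) = integral {a..b} (\<lambda>t. k t z) + integral {b..c} (\<lambda>t. k t z)"
          using Henstock_Kurzweil_Integration.integral_combine[of a b c "\<lambda>t. k t z"] abc(3,4) by simp
        have "(r z + s z) - integral {a..c} (\<lambda>t. k t z) =
            (r z - integral {a..b} (\<lambda>t. k t z)) + (s z - integral {b..c} (\<lambda>t. k t z))"
          unfolding eq by simp
        then have "norm ((r z + s z) - integral {a..c} (\<lambda>t. k t z)) \<le>
            norm (r z - integral {a..b} (\<lambda>t. k t z)) + norm (s z - integral {b..c} (\<lambda>t. k t z))"
          by (metis norm_triangle_ineq)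
        also have "\<dots> \<le> \<epsilon>/2 * (b - a) + \<epsilon>/2 * (c - b)" using r(2)[OF z] s(2)[OF z] by linarith
        also have "\<dots> = \<epsilon>/2 * (c - a)" by (simp flip: distrib_left)
        finally show ?thesis .
      qed
      then show "\<exists>r. approximable \<Omega> M r \<and> (\<forall>z\<in>M. norm (r z - integral {a..c} (\<lambda>t. k t z)) \<le> \<epsilon>/2 * (c - a))"
        using approximable_add[OF r(1) s(1)] by blast
    qed
  next
    fix x :: real assume x: "0 \<le> x" "x \<le> 1"
    have "P a b" if ab: "a \<le> x" "x \<le> b" "b - a < d" for a b
      unfolding P_def
    proof
      assume ab1: "0 \<le> a \<and> b \<le> 1"
      \<comment> \<open>The one-term Riemann sum with node \<open>x\<close>; the minus sign turns
        the kernel \<open>1 / (w - z)\<close> into one with pole at \<open>w\<close>.\<close>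
      define r where "r = (\<lambda>z. (- of_real (b - a) * g x) * (1 / (z - linepath p q x)))"
      have lM: "linepath p q x \<notin> M" using ne x by auto
      then have "approximable \<Omega> M r"
        unfolding r_def using approximable_cmult[OF approximable_pole[OF M] M1] by blast
      moreover have "norm (r z - integral {a..b} (\<lambda>t. k t z)) \<le> \<epsilon>/2 * (b - a)" if z: "z \<in> M" for z
      proof -
        have contab: "continuous_on {a..b} (\<lambda>t. k t z)"
          using ab1 continuous_on_subset[OF contk[OF z]] by auto
        have "k x z * of_real (b - a) = r z"
          using ne[of x z] x z by (simp add: r_def k_def field_simps)
        then have "r z = integral {a..b} (\<lambda>t. k x z)" using ab by (simp add: scaleR_conv_of_real mult.commute)
        then have "r z - integral {a..b} (\<lambda>t. k t z) = integral {a..b} (\<lambda>t. k x z - k t z)"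
          using integral_diff[of "\<lambda>t. k x z" "{a..b}" "\<lambda>t. k t z"] integrable_continuous_real[OF contab]
            integrable_const_ivl[of "k x z" a b]
          by simp
        also have "norm \<dots> \<le> \<epsilon>/2 * (b - a)"
        proof (rule integral_bound)
          show "continuous_on {a..b} (\<lambda>t. k x z - k t z)" using contab by (intro continuous_intros)
          fix t assume "t \<in> {a..b}"
          then have "\<bar>x - t\<bar> < d" "t \<in> {0..1}" using ab ab1 by auto
          then show "norm (k x z - k t z) \<le> \<epsilon>/2"
            using d(2)[of x t z] x z by (simp add: less_imp_le)
        qed (use ab in auto)
        finally show ?thesis .
      qed
      ultimately show "\<exists>r. approximable \<Omega> M r \<and> (\<forall>z\<in>M. norm (r z - integral {a..b} (\<lambda>t. k t z)) \<le> \<epsilon>/2 * (b - a))"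
        by blast
    qed
    then show "\<exists>d>0. \<forall>a b. a \<le> x \<and> x \<le> b \<and> b - a < d \<longrightarrow> P a b" using d(1) by blast
  qed auto
  then obtain r where r: "approximable \<Omega> M r" "\<And>z. z \<in> M \<Longrightarrow> norm (r z - integral {0..1} (\<lambda>t. k t z)) \<le> \<epsilon>/2"
    unfolding P_def by auto
  have "integral {0..1} (\<lambda>t. k t z) = contour_integral (linepath p q) (\<lambda>w. f w / (w - z))" if z: "z \<in> M" for z
  proof -
    have "((\<lambda>t. k t z) has_integral integral {0..1} (\<lambda>t. k t z)) {0..1}"
      using integrable_continuous_real[OF contk[OF z]] by blast
    then have "((\<lambda>w. f w / (w - z)) has_contour_integral integral {0..1} (\<lambda>t. k t z)) (linepath p q)"
      unfolding has_contour_integral_linepath by (simp add: k_def g_def mult.commute)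
    then show ?thesis by (simp add: contour_integral_unique)
  qed
  then have "norm (r z - contour_integral (linepath p q) (\<lambda>w. f w / (w - z))) < \<epsilon>" if "z \<in> M" for z
    using r(2)[OF that] that e by simp
  then show "\<exists>g. approximable \<Omega> M g \<and> (\<forall>z\<in>M. norm (g z - contour_integral (linepath p q) (\<lambda>w. f w / (w - z))) < \<epsilon>)"
    using r(1) by blast
qed

section \<open>Cauchy integrals over the edges of a grid\<close>

lemma isCont_segment_integral:
  assumes f: "continuous_on (closed_segment p q) f" and z: "z \<notin> closed_segment p q"
  shows "isCont (\<lambda>z. contour_integral (linepath p q) (\<lambda>w. f w / (w - z))) z"
proof -
  have "((\<lambda>z. contour_integral (linepath p q) (\<lambda>w. f w / (w - z))) has_field_derivative
      (of_nat 1 * contour_integral (linepath p q) (\<lambda>u. f u / (u - z) ^ Suc 1))) (at z)"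
  proof (rule Cauchy_next_derivative(2)[where S = UNIV and B = "norm (q - p)"])
    show "continuous_on (path_image (linepath p q)) f" using f by simp
    show "norm (vector_derivative (linepath p q) (at t)) \<le> norm (q - p)" for t by simp
    fix w assume "w \<in> UNIV - path_image (linepath p q)"
    then have "continuous_on (closed_segment p q) (\<lambda>u. f u / (u - w) ^ 1)"
      by (intro continuous_intros f) auto
    then show "((\<lambda>u. f u / (u - w) ^ 1) has_contour_integral
        contour_integral (linepath p q) (\<lambda>u. f u / (u - w))) (linepath p q)"
      using contour_integrable_continuous_linepath has_contour_integral_integral by fastforce
  qed (use z in auto)
  then show ?thesis by (rule DERIV_isCont)
qed

text \<open>All edges are oriented to the right or upwards, so an edge common to two squares gives
  the same integral with opposite signs.\<close>

lemma rectpath_integral_edges: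
  assumes F: "(F has_contour_integral I) (rectpath (Complex a b) (Complex c d))"
  shows "I = contour_integral (linepath (Complex a b) (Complex c b)) F
           + contour_integral (linepath (Complex c b) (Complex c d)) F
           - contour_integral (linepath (Complex a d) (Complex c d)) F
           - contour_integral (linepath (Complex a b) (Complex a d)) F"
proof -
  have i: "F contour_integrable_on linepath (Complex a b) (Complex c b)"
    "F contour_integrable_on linepath (Complex c b) (Complex c d)"
    "F contour_integrable_on linepath (Complex c d) (Complex a d)"
    "F contour_integrable_on linepath (Complex a d) (Complex a b)"
    using F has_contour_integral_integrable by (fastforce simp: rectpath_def Let_def)+
  have rev: "contour_integral (linepath p q) F = - contour_integral (linepath q p) F"
    if "F contour_integrable_on linepath p q" for p q
    using has_contour_integral_reverse_linepath[OF has_contour_integral_integral[OF that]]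
    by (simp add: contour_integral_unique)
  have "I = contour_integral (linepath (Complex a b) (Complex c b)) F
           + (contour_integral (linepath (Complex c b) (Complex c d)) F
           + (contour_integral (linepath (Complex c d) (Complex a d)) F
           + contour_integral (linepath (Complex a d) (Complex a b)) F))"
    using contour_integral_unique[OF F] i
    by (simp add: rectpath_def Let_def)
  then show ?thesis using rev[OF i(3)] rev[OF i(4)] by simp
qed

lemma sum_diff_shift:
  fixes h :: "'a \<Rightarrow> 'b::ab_group_add"
  assumes "finite S" "inj g"
  shows "(\<Sum>p\<in>S. h p - h (g p)) = (\<Sum>p\<in>S - g ` S. h p) - (\<Sum>p\<in>g ` S - S. h p)"
proof -
  have "(\<Sum>p\<in>S. h (g p)) = (\<Sum>p\<in>g ` S. h p)"
    using assms by (simp add: sum.reindex inj_on_subset)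
  moreover have "sum h S = sum h (S \<inter> g ` S) + sum h (S - g ` S)"
    "sum h (g ` S) = sum h (S \<inter> g ` S) + sum h (g ` S - S)"
    using sum.Int_Diff[of S h "g ` S"] sum.Int_Diff[of "g ` S" h S] assms by (simp_all add: Int_commute)
  ultimately show ?thesis by (simp add: sum_subtractf)
qed

text \<open>Cauchy's formula on the squares of a fine grid that meet \<open>M\<close>: the edges shared by two such squares
  cancel, and the remaining ones do not meet \<open>M\<close>, since otherwise both adjacent squares would meet \<open>M\<close>.
  Points of \<open>M\<close> on a grid line are reached by continuity.\<close>

lemma runge:
  assumes M: "convex_relative \<Omega> M" and U: "open U" "M \<subseteq> U" and f: "f holomorphic_on U"
  shows "approximable \<Omega> M f"
proof (cases "M = {}")
  case True
  then show ?thesis by (auto simp: approximable_def intro!: exI[of _ "\<lambda>_. 0"])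
next
  case False
  have M1: "compact M" "M \<subseteq> \<Omega>" using M by (auto simp: convex_relative_iff)
  obtain e where e: "e > 0" "{x. infdist x M \<le> e} \<subseteq> U"
    using compact_in_open_separated[OF False M1(1) U] by blast
  \<comment> \<open>Two points of a square of side \<delta> differ by at most \<delta> in each
    coordinate, hence by at most \<open>2 * \<delta> = e\<close> in norm. So a square meeting
    \<open>M\<close> stays in \<open>U\<close>.\<close>
  define \<delta> where "\<delta> = e / 2"
  have \<delta>: "\<delta> > 0" using e by (simp add: \<delta>_def)
  define pt where "pt = (\<lambda>p :: int \<times> int. Complex (\<delta> * of_int (fst p)) (\<delta> * of_int (snd p)))"
  define up where "up = (\<lambda>p :: int \<times> int. (fst p, snd p + 1))"
  define rt where "rt = (\<lambda>p :: int \<times> int. (fst p + 1, snd p))"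
  define sq where "sq = (\<lambda>p. cbox (pt p) (pt (rt (up p))))"
  have pt_simps: "Re (pt p) = \<delta> * of_int (fst p)" "Im (pt p) = \<delta> * of_int (snd p)"
    "fst (up p) = fst p" "snd (up p) = snd p + 1" "fst (rt p) = fst p + 1" "snd (rt p) = snd p" for p
    by (auto simp: pt_def up_def rt_def)
  note defs = in_cbox_complex_iff in_box_complex_iff pt_simps
  have seg: "closed_segment (pt p) (pt (rt p)) \<subseteq> sq p" "closed_segment (pt p) (pt (up p)) \<subseteq> sq p"
    "closed_segment (pt (up p)) (pt (rt (up p))) \<subseteq> sq p" "closed_segment (pt (rt p)) (pt (up (rt p))) \<subseteq> sq p" for p
    using \<delta> unfolding sq_def
    by (intro closed_segment_subset; simp add: defs algebra_simps)+
  define S where "S = {p. sq p \<inter> M \<noteq> {}}"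
  have SU: "sq p \<subseteq> U" if p: "p \<in> S" for p
  proof
    fix w assume w: "w \<in> sq p"
    obtain z where z: "z \<in> sq p" "z \<in> M" using p by (auto simp: S_def)
    have "\<bar>Re (w - z)\<bar> \<le> \<delta>" "\<bar>Im (w - z)\<bar> \<le> \<delta>"
      using w z unfolding sq_def by (auto simp: defs algebra_simps)
    then have "norm (w - z) \<le> e" using cmod_le[of "w - z"] by (simp add: \<delta>_def)
    then have "infdist w M \<le> e" using infdist_le[OF z(2), of w] by (simp add: dist_norm)
    then show "w \<in> U" using e by blast
  qed
  have "finite S"
  proof -
    obtain r where r: "\<And>z. z \<in> M \<Longrightarrow> norm z \<le> r"
      using compact_imp_bounded[OF M1(1)] by (auto simp: bounded_iff)
    define n where "n = \<lceil>r / \<delta>\<rceil> + 1"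
    have n: "r / \<delta> + 1 \<le> of_int n" by (simp add: n_def)
    have "S \<subseteq> {-n..n} \<times> {-n..n}"
    proof
      fix p assume "p \<in> S"
      then obtain z where z: "z \<in> sq p" "z \<in> M" by (auto simp: S_def)
      have "\<bar>Re z\<bar> \<le> r" "\<bar>Im z\<bar> \<le> r"
        using r[OF z(2)] abs_Re_le_cmod[of z] abs_Im_le_cmod[of z] by auto
      moreover have "\<delta> * of_int (fst p) \<le> Re z" "Re z \<le> \<delta> * (of_int (fst p) + 1)"
        "\<delta> * of_int (snd p) \<le> Im z" "Im z \<le> \<delta> * (of_int (snd p) + 1)"
        using z(1) unfolding sq_def by (auto simp: defs)
      ultimately have "\<delta> * of_int (fst p) \<le> r" "- r \<le> \<delta> * (of_int (fst p) + 1)"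
        "\<delta> * of_int (snd p) \<le> r" "- r \<le> \<delta> * (of_int (snd p) + 1)" by auto
      then have "of_int (fst p) \<le> r / \<delta>" "- (r / \<delta>) \<le> of_int (fst p) + 1"
        "of_int (snd p) \<le> r / \<delta>" "- (r / \<delta>) \<le> of_int (snd p) + 1"
        using \<delta> by (auto simp: field_simps)
      then have "real_of_int (fst p) \<le> of_int n" "- of_int n \<le> real_of_int (fst p)"
        "real_of_int (snd p) \<le> of_int n" "- of_int n \<le> real_of_int (snd p)" using n by linarith+
      then show "p \<in> {-n..n} \<times> {-n..n}" by (cases p) auto
    qed
    then show ?thesis by (rule finite_subset) auto
  qed
  define h where "h = (\<lambda>p z. contour_integral (linepath (pt p) (pt (rt p))) (\<lambda>w. f w / (w - z)))"
  define v where "v = (\<lambda>p z. contour_integral (linepath (pt p) (pt (up p))) (\<lambda>w. f w / (w - z)))"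
  \<comment> \<open>The sum over those edges that belong to exactly one square of \<open>S\<close>:
    lower minus upper edges, then left minus right edges with the sign reversed.\<close>
  define G where "G = (\<lambda>z. ((\<Sum>p\<in>S - up ` S. h p z) - (\<Sum>p\<in>up ` S - S. h p z))
                   - ((\<Sum>p\<in>S - rt ` S. v p z) - (\<Sum>p\<in>rt ` S - S. v p z)))"
  have hgood: "closed_segment (pt p) (pt (rt p)) \<inter> M = {} \<and> closed_segment (pt p) (pt (rt p)) \<subseteq> U"
    if pS: "p \<in> (S - up ` S) \<union> (up ` S - S)" for p
  proof -
    define p' where "p' = (fst p, snd p - 1)"
    have p': "p = up p'" by (simp add: p'_def up_def)
    have "p \<in> up ` S \<longleftrightarrow> p' \<in> S" by (auto simp: p' up_def image_iff prod_eq_iff)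
    then consider "p \<in> S" "p' \<notin> S" | "p' \<in> S" "p \<notin> S" using pS by blast
    then show ?thesis
      using seg(1)[of p] seg(3)[of p'] SU[of p] SU[of p'] unfolding S_def p' by cases blast+
  qed
  have vgood: "closed_segment (pt p) (pt (up p)) \<inter> M = {} \<and> closed_segment (pt p) (pt (up p)) \<subseteq> U"
    if pS: "p \<in> (S - rt ` S) \<union> (rt ` S - S)" for p
  proof -
    define p' where "p' = (fst p - 1, snd p)"
    have p': "p = rt p'" by (simp add: p'_def rt_def)
    have "p \<in> rt ` S \<longleftrightarrow> p' \<in> S" by (auto simp: p' rt_def image_iff prod_eq_iff)
    then consider "p \<in> S" "p' \<notin> S" | "p' \<in> S" "p \<notin> S" using pS by blast
    then show ?thesis
      using seg(2)[of p] seg(4)[of p'] SU[of p] SU[of p'] unfolding S_def p' by cases blast+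
  qed
  have contf: "continuous_on U f" using f holomorphic_on_imp_continuous_on by blast
  have eqbox: "G z = 2 * of_real pi * \<i> * f z" if p0: "p0 \<in> S" "z \<in> box (pt p0) (pt (rt (up p0)))" for z p0
  proof -
    have I: "h p z + v (rt p) z - h (up p) z - v p z = (if p = p0 then 2 * of_real pi * \<i> * f z else 0)"
      if p: "p \<in> S" for p
    proof -
      have fsq: "f holomorphic_on sq p" using SU[OF p] f holomorphic_on_subset by blast
      have "((\<lambda>w. f w / (w - z)) has_contour_integral (if p = p0 then 2 * of_real pi * \<i> * f z else 0))
          (rectpath (pt p) (pt (rt (up p))))"
      proof (cases "p = p0")
        case True
        have "((\<lambda>w. f w / (w - z)) has_contour_integral
            (2 * pi * \<i> * winding_number (rectpath (pt p) (pt (rt (up p)))) z * f z))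
          (rectpath (pt p) (pt (rt (up p))))"
        proof (rule Cauchy_integral_formula_convex_simple[OF _ fsq])
          show "convex (sq p)" by (simp add: sq_def)
          show "z \<in> interior (sq p)" using p0(2) True by (simp add: sq_def)
          have "path_image (rectpath (pt p) (pt (rt (up p)))) = cbox (pt p) (pt (rt (up p))) - box (pt p) (pt (rt (up p)))"
            using \<delta> by (intro path_image_rectpath_cbox_minus_box) (auto simp: pt_simps)
          then show "path_image (rectpath (pt p) (pt (rt (up p)))) \<subseteq> sq p - {z}"
            using p0(2) True unfolding sq_def by auto
        qed auto
        then show ?thesis using winding_number_rectpath[OF p0(2)] True by simp
      next
        case False
        have "z \<notin> sq p"
        proof
          assume zp: "z \<in> sq p"
          have "\<delta> * of_int (fst p0) < \<delta> * of_int (fst p + 1)" "\<delta> * of_int (fst p) < \<delta> * of_int (fst p0 + 1)"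
            "\<delta> * of_int (snd p0) < \<delta> * of_int (snd p + 1)" "\<delta> * of_int (snd p) < \<delta> * of_int (snd p0 + 1)"
            using p0(2) zp unfolding sq_def by (auto simp: defs)
          then have "fst p0 < fst p + 1" "fst p < fst p0 + 1" "snd p0 < snd p + 1" "snd p < snd p0 + 1"
            using \<delta> by (simp_all only: mult_less_cancel_left_pos of_int_less_iff)
          then show False using False by (simp add: prod_eq_iff)
        qed
        then have "(\<lambda>w. f w / (w - z)) holomorphic_on sq p"
          using fsq by (intro holomorphic_intros) auto
        then have "((\<lambda>w. f w / (w - z)) has_contour_integral 0) (rectpath (pt p) (pt (rt (up p))))"
          using \<delta> path_image_rectpath_subset_cbox[of "pt p" "pt (rt (up p))"]
          by (intro Cauchy_theorem_convex_simple[where S = "sq p"]) (auto simp: sq_def pt_simps)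
        then show ?thesis using False by simp
      qed
      from rectpath_integral_edges[OF this[unfolded pt_def]]
      show ?thesis by (simp add: h_def v_def pt_def up_def rt_def)
    qed
    have "2 * of_real pi * \<i> * f z = (\<Sum>p\<in>S. h p z + v (rt p) z - h (up p) z - v p z)"
      using p0(1) \<open>finite S\<close> by (simp add: I)
    also have "\<dots> = (\<Sum>p\<in>S. h p z - h (up p) z) - (\<Sum>p\<in>S. v p z - v (rt p) z)"
      by (simp flip: sum_subtractf add: algebra_simps)
    also have "\<dots> = G z"
      unfolding G_def using \<open>finite S\<close>
      by (subst (1 2) sum_diff_shift) (auto simp: inj_def up_def rt_def prod_eq_iff)
    finally show ?thesis by simp
  qed
  have eq: "G z = 2 * of_real pi * \<i> * f z" if z: "z \<in> M" for z
  proof -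
    have "isCont (h p) z" if "p \<in> (S - up ` S) \<union> (up ` S - S)" for p
      unfolding h_def
    proof (rule isCont_segment_integral)
      show "continuous_on (closed_segment (pt p) (pt (rt p))) f"
        using hgood[OF that] continuous_on_subset[OF contf] by simp
      show "z \<notin> closed_segment (pt p) (pt (rt p))" using hgood[OF that] z by blast
    qed
    moreover have "isCont (v p) z" if "p \<in> (S - rt ` S) \<union> (rt ` S - S)" for p
      unfolding v_def
    proof (rule isCont_segment_integral)
      show "continuous_on (closed_segment (pt p) (pt (up p))) f"
        using vgood[OF that] continuous_on_subset[OF contf] by simp
      show "z \<notin> closed_segment (pt p) (pt (up p))" using vgood[OF that] z by blast
    qed
    ultimately have contG: "isCont G z"
      unfolding G_def by (intro continuous_diff continuous_sum) auto
    have contfz: "isCont f z" using contf U z by (metis continuous_on_eq_continuous_at subsetD)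
    define H where "H = (\<lambda>z. G z - 2 * of_real pi * \<i> * f z)"
    have "isCont H z" unfolding H_def by (intro continuous_intros contG contfz)
    moreover have "((\<lambda>t. z + of_real t * Complex 1 1) \<longlongrightarrow> z) (at_right 0)"
      by (auto intro!: tendsto_eq_intros)
    ultimately have lim: "((\<lambda>t. H (z + of_real t * Complex 1 1)) \<longlongrightarrow> H z) (at_right 0)"
      by (rule isCont_tendsto_compose)
    \<comment> \<open>Rounding down puts \<open>z\<close> in the interior of the square or on its
      left or lower edge, so a short move in the direction \<open>Complex 1 1\<close> enters the
      open square.\<close>
    define p0 where "p0 = (\<lfloor>Re z / \<delta>\<rfloor>, \<lfloor>Im z / \<delta>\<rfloor>)"
    have fl: "\<delta> * of_int \<lfloor>x / \<delta>\<rfloor> \<le> x" "x < \<delta> * (of_int \<lfloor>x / \<delta>\<rfloor> + 1)" for x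
    proof -
      show "\<delta> * of_int \<lfloor>x / \<delta>\<rfloor> \<le> x"
        using of_int_floor_le[of "x / \<delta>"] pos_le_divide_eq[OF \<delta>, of "of_int \<lfloor>x / \<delta>\<rfloor>" x]
        by (metis mult.commute)
      have "x / \<delta> < of_int \<lfloor>x / \<delta>\<rfloor> + 1" by linarith
      then show "x < \<delta> * (of_int \<lfloor>x / \<delta>\<rfloor> + 1)"
        using pos_divide_less_eq[OF \<delta>] by (metis mult.commute)
    qed
    have "z \<in> sq p0" using fl[of "Re z"] fl[of "Im z"] by (auto simp: sq_def defs p0_def)
    then have p0: "p0 \<in> S" using z by (auto simp: S_def)
    define b where "b = min (\<delta> * (of_int \<lfloor>Re z / \<delta>\<rfloor> + 1) - Re z) (\<delta> * (of_int \<lfloor>Im z / \<delta>\<rfloor> + 1) - Im z)"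
    have "b > 0" using fl[of "Re z"] fl[of "Im z"] by (simp add: b_def)
    have "H (z + of_real t * Complex 1 1) = 0" if t: "0 < t" "t < b" for t
    proof -
      have "z + of_real t * Complex 1 1 \<in> box (pt p0) (pt (rt (up p0)))"
        using t fl[of "Re z"] fl[of "Im z"] by (auto simp: defs p0_def b_def)
      then show ?thesis using eqbox[OF p0] by (simp add: H_def)
    qed
    then have "eventually (\<lambda>t. H (z + of_real t * Complex 1 1) = 0) (at_right 0)"
      using \<open>b > 0\<close> eventually_at_right by blast
    then have "((\<lambda>t. H (z + of_real t * Complex 1 1)) \<longlongrightarrow> 0) (at_right 0)"
      by (rule tendsto_eventually)
    then have "H z = 0" using lim tendsto_unique[OF trivial_limit_at_right_real] by blast
    then show ?thesis by (simp add: H_def)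
  qed
  have "approximable \<Omega> M (h p)" if "p \<in> (S - up ` S) \<union> (up ` S - S)" for p
    unfolding h_def using hgood[OF that] continuous_on_subset[OF contf]
    by (intro approximable_segment_integral M) auto
  moreover have "approximable \<Omega> M (v p)" if "p \<in> (S - rt ` S) \<union> (rt ` S - S)" for p
    unfolding v_def using vgood[OF that] continuous_on_subset[OF contf]
    by (intro approximable_segment_integral M) auto
  moreover have diff: "approximable \<Omega> M (\<lambda>z. a z - b z)" if "approximable \<Omega> M a" "approximable \<Omega> M b" for a b
    using approximable_add[OF that(1) approximable_cmult[OF that(2) M1, of "-1"]] by simp
  ultimately have "approximable \<Omega> M G"
    unfolding G_def using \<open>finite S\<close> by (intro diff approximable_sum) auto
  then have "approximable \<Omega> M (\<lambda>z. (1 / (2 * of_real pi * \<i>)) * G z)" by (rule approximable_cmult[OF _ M1])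
  moreover have "(1 / (2 * of_real pi * \<i>)) * G z = f z" if "z \<in> M" for z using eq[OF that] by simp
  ultimately show ?thesis using approximable_cong by (metis (no_types, lifting))
qed

section \<open>Unions of disjoint relatively convex sets\<close>

text \<open>\<open>R\<close> consists of representatives of distinct components of
  \<open>- K\<close>. A lower bound on the number of components in this form is carried along by
  maps defined on \<Omega> only.\<close>

definition separated_points :: "complex set \<Rightarrow> complex set \<Rightarrow> bool" where
  "separated_points K R \<longleftrightarrow> R \<inter> K = {} \<and> pairwise (\<lambda>x y. \<not> connected_component (- K) x y) R"

lemma separated_points_image:
  assumes "open \<Omega>" "connected \<Omega>" "compact K" "K \<subseteq> \<Omega>" "R \<subseteq> \<Omega>"
    and "\<psi> holomorphic_on \<Omega>" "inj_on \<psi> \<Omega>" and sep: "separated_points K R"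
  shows "separated_points (\<psi> ` K) (\<psi> ` R)"
proof -
  have "\<psi> ` R \<inter> \<psi> ` K = {}"
    using sep inj_on_image_Int[OF assms(7), of R K] assms(4,5) by (simp add: separated_points_def)
  moreover have "pairwise (\<lambda>x y. \<not> connected_component (- \<psi> ` K) x y) (\<psi> ` R)"
  proof (rule pairwiseI, clarify)
    fix x y assume xy: "x \<in> R" "y \<in> R" "\<psi> x \<noteq> \<psi> y" "connected_component (- \<psi> ` K) (\<psi> x) (\<psi> y)"
    then have "connected_component (- K) x y"
      using connected_component_image_iff[OF assms(1-4) _ _ assms(6,7), of x y] assms(5) by auto
    then show False
      using sep xy(1-3) by (auto simp: separated_points_def pairwise_def)
  qed
  ultimately show ?thesis by (simp add: separated_points_def)
qed

text \<open>Each compact piece of the complement is enclosed by an open set whose frontier is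
  compact in \<Omega>. Once \<open>K\<close> contains these frontiers, points of different pieces
  lie in different components of \<open>- K\<close>.\<close>

lemma convex_relative_superset_with_separated_points:
  assumes \<Omega>: "open \<Omega>" "connected \<Omega>" "\<Omega> \<noteq> {}" "\<not> finitely_connected \<Omega>" and L: "compact L" "L \<subseteq> \<Omega>"
  obtains K R where "convex_relative \<Omega> K" "connected K" "K \<noteq> {}" "L \<subseteq> K"
    "R \<subseteq> \<Omega>" "finite R" "card R = n" "separated_points K R"
proof -
  obtain \<A> where A: "finite \<A>" "card \<A> = n" "disjoint \<A>"
    "\<And>A. A \<in> \<A> \<Longrightarrow> compact A \<and> A \<noteq> {} \<and> A \<subseteq> - \<Omega> \<and> closed (- \<Omega> - A)"
    using complement_compact_pieces[OF \<Omega>(1,4), of n] by metis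
  have "\<exists>U. A \<subseteq> U \<and> U \<inter> (- \<Omega> - A) = {} \<and> compact (frontier U) \<and> frontier U \<subseteq> \<Omega>" if A': "A \<in> \<A>" for A
  proof -
    obtain U V where U: "open U" "compact (closure U)" "open V" "A \<subseteq> U" "- \<Omega> - A \<subseteq> V" "U \<inter> V = {}"
      using separation_normal_compact[of A "- \<Omega> - A"] A(4)[OF A'] by (metis Diff_disjoint)
    have "V \<inter> closure U = {}" using open_Int_closure_eq_empty[OF U(3), of U] U(6) by blast
    moreover have "frontier U = closure U - U" using U(1) by (simp add: frontier_def interior_open)
    ultimately have "frontier U \<subseteq> \<Omega>" using U(4,5) by blast
    moreover have "compact (frontier U)" using U(2) by (simp add: compact_frontier_bounded bounded_subset[OF compact_imp_bounded closure_subset])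
    ultimately show ?thesis using U by blast
  qed
  then obtain U where U: "\<And>A. A \<in> \<A> \<Longrightarrow> A \<subseteq> U A \<and> U A \<inter> (- \<Omega> - A) = {} \<and> compact (frontier (U A)) \<and> frontier (U A) \<subseteq> \<Omega>"
    by metis
  have "compact (L \<union> (\<Union>A\<in>\<A>. frontier (U A)))" "L \<union> (\<Union>A\<in>\<A>. frontier (U A)) \<subseteq> \<Omega>"
    using L U A(1) by (auto intro!: compact_Un compact_UN)
  then obtain K where K: "convex_relative \<Omega> K" "connected K" "K \<noteq> {}" "L \<union> (\<Union>A\<in>\<A>. frontier (U A)) \<subseteq> K"
    using convex_relative_hull[OF \<Omega>(1-3)] by metis
  have K1: "compact K" "K \<subseteq> \<Omega>" using K(1) by (auto simp: convex_relative_iff)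
  \<comment> \<open>Points of the pieces lie outside \<Omega>; each is exchanged for a point of
    \<Omega> in the same component of \<open>- K\<close>.\<close>
  have "\<exists>r a. r \<in> \<Omega> \<and> a \<in> A \<and> connected_component (- K) a r" if A': "A \<in> \<A>" for A
  proof -
    obtain a where a: "a \<in> A" using A(4)[OF A'] by blast
    then have "a \<in> - K" using A(4)[OF A'] K1 by blast
    then have "connected_component_set (- K) a \<in> components (- K)" by (simp add: componentsI)
    then show ?thesis
      using component_meets_open[OF compact_imp_closed[OF K1(1)] K(3) K1(2) \<Omega>(1)] a by blast
  qed
  then obtain r a where r: "\<And>A. A \<in> \<A> \<Longrightarrow> r A \<in> \<Omega> \<and> a A \<in> A \<and> connected_component (- K) (a A) (r A)"
    by metis
  have sep: "\<not> connected_component (- K) (r A) (r B)" if AB: "A \<in> \<A>" "B \<in> \<A>" "A \<noteq> B" for A B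
  proof
    assume "connected_component (- K) (r A) (r B)"
    then have "connected_component (- K) (a A) (a B)"
      using r AB connected_component_sym connected_component_trans by metis
    then obtain T where T: "connected T" "T \<subseteq> - K" "a A \<in> T" "a B \<in> T" by (auto simp: connected_component_def)
    have "a B \<notin> A" using r[OF AB(2)] A(3) AB unfolding disjoint_def by blast
    then have "a B \<notin> U A" using U[OF AB(1)] r[OF AB(2)] A(4)[OF AB(2)] by blast
    moreover have "a A \<in> U A" using U[OF AB(1)] r[OF AB(1)] by blast
    ultimately have "T \<inter> frontier (U A) \<noteq> {}"
      using connected_Int_frontier[OF T(1), of "U A"] T by blast
    then show False using T(2) K(4) AB(1) by blast
  qed
  have rK: "r A \<notin> K" if "A \<in> \<A>" for A using r[OF that] connected_component_in by blast
  have "inj_on r \<A>"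
  proof (rule inj_onI)
    fix A B assume "A \<in> \<A>" "B \<in> \<A>" "r A = r B"
    then show "A = B" using sep[of A B] rK[of A] connected_component_refl[of "r A" "- K"] by auto
  qed
  then have "card (r ` \<A>) = n" using A(2) by (simp add: card_image)
  moreover have "separated_points K (r ` \<A>)"
    using rK sep unfolding separated_points_def pairwise_def by blast
  ultimately show ?thesis using that[of K "r ` \<A>"] K r A(1) by auto
qed

text \<open>The situation to be refuted: disjoint connected \<Omega>-convex sets, none with a
  forbidden hole of its own, whose union has a hole around \<open>x\<close> filled by
  \<Omega>.\<close>

locale junction =
  fixes \<Omega> :: "complex set" and I :: "'i set" and L :: "'i \<Rightarrow> complex set" and x :: complex
  assumes finite_I: "finite I"
    and L: "\<And>i. i \<in> I \<Longrightarrow> convex_relative \<Omega> (L i) \<and> connected (L i) \<and> L i \<noteq> {}"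
    and disj: "disjoint_family_on L I"
    and x: "x \<notin> (\<Union>i\<in>I. L i)"
    and hole: "bounded (connected_component_set (- (\<Union>i\<in>I. L i)) x)"
      "connected_component_set (- (\<Union>i\<in>I. L i)) x \<subseteq> \<Omega>"
begin

text \<open>The side of \<open>L i\<close> from which it faces the hole.\<close>

definition C :: "'i \<Rightarrow> complex set" where "C i = connected_component_set (- L i) x"

text \<open>Inclusion-minimal sides belong to the sets facing the hole directly. Every other set
  lies behind one of these as seen from \<open>x\<close>, and the minimal sides alone cut out the
  hole.\<close>

definition J :: "'i set" where "J = {i \<in> I. \<forall>j\<in>I. C j \<subseteq> C i \<longrightarrow> C j = C i}"

lemma J_subset: "J \<subseteq> I" by (auto simp: J_def)

lemma compact_L: "i \<in> I \<Longrightarrow> compact (L i)" using L by (auto simp: convex_relative_iff)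

lemma disjD: "i \<in> I \<Longrightarrow> j \<in> I \<Longrightarrow> i \<noteq> j \<Longrightarrow> L i \<inter> L j = {}"
  using disj by (auto simp: disjoint_family_on_def)

lemma x_in_C: "i \<in> I \<Longrightarrow> x \<in> C i" using x by (auto simp: C_def)

lemma C_component: "i \<in> I \<Longrightarrow> C i \<in> components (- L i)"
  using x by (auto simp: C_def componentsI)

lemma C_disjoint_L: "i \<in> I \<Longrightarrow> C i \<inter> L i = {}"
  using in_components_subset[OF C_component] by blast

lemma subset_C:
  assumes "i \<in> I" "connected T" "T \<inter> L i = {}" "T \<inter> C i \<noteq> {}"
  shows "T \<subseteq> C i"
  using components_maximal[OF C_component[OF assms(1)], of T] assms by blast

text \<open>A common side would have its frontier in both of the disjoint sets \<open>L i\<close>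
  and \<open>L j\<close>, so its frontier would be empty and the side the whole plane.\<close>

lemma C_neq:
  assumes "i \<in> I" "j \<in> I" "i \<noteq> j" shows "C i \<noteq> C j"
proof
  assume eq: "C i = C j"
  have "frontier (C i) \<subseteq> L i" "frontier (C j) \<subseteq> L j"
    using frontier_of_components_closed_complement C_component compact_L assms compact_imp_closed by metis+
  then have "frontier (C i) = {}" using eq disjD[OF assms] by auto
  then have "C i = UNIV" using x_in_C[OF assms(1)] by (metis empty_iff frontier_eq_empty)
  then show False using C_disjoint_L[OF assms(1)] L[OF assms(1)] by blast
qed

lemma J_below:
  assumes "i \<in> I" shows "\<exists>j\<in>J. C j \<subseteq> C i"
proof -
  obtain M where M: "M \<in> C ` I" "M \<subseteq> C i" "\<And>B. B \<in> C ` I \<Longrightarrow> B \<subseteq> M \<Longrightarrow> M = B"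
    using finite_has_minimal2[of "C ` I" "C i"] finite_I assms by (metis finite_imageI imageI)
  then obtain j where "j \<in> I" "M = C j" by blast
  then show ?thesis using M by (intro bexI[of _ j]) (auto simp: J_def)
qed

text \<open>If \<open>L i\<close> missed \<open>C j\<close>, the connected set \<open>C j\<close>
  through \<open>x\<close> would be contained in \<open>C i\<close>, against minimality. So
  \<open>L i\<close> meets \<open>C j\<close>, and being connected and disjoint from
  \<open>L j\<close> it cannot leave it.\<close>

lemma L_subset_C:
  assumes "i \<in> J" "j \<in> J" "i \<noteq> j" shows "L i \<subseteq> C j"
proof -
  have I: "i \<in> I" "j \<in> I" using assms J_subset by auto
  have "L i \<inter> C j \<noteq> {}"
  proof
    assume "L i \<inter> C j = {}"
    then have "C j \<subseteq> C i"
      using subset_C[OF I(1), of "C j"] in_components_connected[OF C_component[OF I(2)]] x_in_C I by blast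
    then show False using assms(1) I C_neq[OF I assms(3)] by (auto simp: J_def)
  qed
  then show ?thesis using subset_C[OF I(2), of "L i"] L[OF I(1)] disjD[OF I assms(3)] by blast
qed

lemma connected_Compl_C: "i \<in> I \<Longrightarrow> connected (- C i)"
  using component_complement_connected L C_component by blast

text \<open>Thus the far sides \<open>- C i\<close> of the facing sets are pairwise disjoint. They
  are connected since \<open>L i\<close> is, and \<open>- C i\<close> misses \<open>L j\<close>
  because \<open>L j\<close> lies in \<open>C i\<close>.\<close>

lemma Compl_C_subset:
  assumes "i \<in> J" "j \<in> J" "i \<noteq> j" shows "- C i \<subseteq> C j"
proof (rule subset_C)
  have I: "i \<in> I" "j \<in> I" using assms J_subset by auto
  show "j \<in> I" using I by simp
  show "connected (- C i)" using connected_Compl_C I by blast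
  show "- C i \<inter> L j = {}" using L_subset_C[of j i] assms by blast
  show "- C i \<inter> C j \<noteq> {}" using L_subset_C[OF assms] C_disjoint_L[OF I(1)] L[OF I(1)] by blast
qed

text \<open>Each side contains a minimal one, so no single \<open>L i\<close> separates
  \<open>y\<close> from \<open>x\<close>; by Janiszewski's theorem neither does the disjoint
  union.\<close>

lemma Inter_C: "(\<Inter>i\<in>J. C i) \<subseteq> connected_component_set (- (\<Union>i\<in>I. L i)) x"
proof
  fix y assume y: "y \<in> (\<Inter>i\<in>J. C i)"
  have "connected_component (- L i) x y" if "i \<in> I" for i
    using J_below[OF that] y by (auto simp: C_def)
  then have "connected_component (- (\<Union>i\<in>I. L i)) x y"
    using connected_component_UN_disjoint[OF finite_I compact_L disj] by blast
  then show "y \<in> connected_component_set (- (\<Union>i\<in>I. L i)) x" by simp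
qed

text \<open>Inside the hole around \<open>x\<close>, the component \<open>Y\<close> would be bounded
  and contained in \<Omega>. In use, this says that \<open>Y\<close> must reach some far side
  \<open>- C i\<close>.\<close>

lemma not_hole:
  assumes "convex_relative \<Omega> M" "Y \<in> components (- M)" shows "\<not> Y \<subseteq> (\<Inter>i\<in>J. C i)"
proof
  assume "Y \<subseteq> (\<Inter>i\<in>J. C i)"
  then have "Y \<subseteq> connected_component_set (- (\<Union>i\<in>I. L i)) x" using Inter_C by blast
  then have "bounded Y" "Y \<subseteq> \<Omega>" using hole bounded_subset by blast+
  then show False using assms unfolding convex_relative_iff by blast
qed

text \<open>If \<open>i\<close> were the only index, \<open>C i\<close> itself would be a hole of
  \<open>L i\<close> filled by \<Omega>.\<close>

lemma J_other:
  assumes "i \<in> J" obtains j where "j \<in> J" "j \<noteq> i"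
proof -
  have "i \<in> I" using assms J_subset by blast
  then have "\<not> C i \<subseteq> (\<Inter>i\<in>J. C i)" using not_hole[of "L i" "C i"] L C_component by blast
  then show ?thesis using that by blast
qed

lemma L_outside:
  assumes "i \<in> I" "i \<notin> J" obtains j where "j \<in> J" "L i \<inter> C j = {}"
  using J_below[OF assms(1)] C_disjoint_L[OF assms(1)] that by blast

text \<open>Each component of \<open>- c\<close> away from \<open>L j\<close> lies in \<open>C j\<close>, is not filled by \<open>\<Omega>\<close>, and hence
  swallows one of the connected sets \<open>- C i\<close> with \<open>i \<in> J - {j}\<close>.\<close>

lemma few_separated_points:
  assumes j: "j \<in> J" and L': "\<And>i. i \<in> I \<Longrightarrow> L i \<subseteq> L' i" "disjoint_family_on L' I" "connected (L' j)"
    and c: "convex_relative \<Omega> c" "connected c" "c \<noteq> {}" "c \<subseteq> L' j" "c \<subseteq> C j"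
    and R: "finite R" "separated_points c R"
  shows "card R \<le> card I"
proof -
  have jI: "j \<in> I" using j J_subset by blast
  have cc: "closed c" using c(1) compact_imp_closed by (auto simp: convex_relative_iff)
  define Y where "Y = (\<lambda>r. connected_component_set (- c) r)"
  have Ysep: "r = s" if "r \<in> R" "s \<in> R" "Y r \<inter> Y s \<noteq> {}" for r s
  proof (rule ccontr)
    assume "r \<noteq> s"
    have "connected_component (- c) r s"
      using that(3) unfolding Y_def by (metis connected_component_nonoverlap connected_component_eq_eq)
    then show False using that R(2) \<open>r \<noteq> s\<close> unfolding separated_points_def pairwise_def by blast
  qed
  have "\<exists>i\<in>J. i \<noteq> j \<and> - C i \<subseteq> Y r" if r: "r \<in> R" "L j \<inter> Y r = {}" for r
  proof -
    have "r \<notin> c" using r(1) R(2) by (auto simp: separated_points_def)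
    then have Yc: "Y r \<in> components (- c)" by (simp add: Y_def componentsI)
    have "c \<union> Y r \<subseteq> C j"
    proof (rule subset_C[OF jI])
      show "connected (c \<union> Y r)" using connected_Un_component[OF cc c(2) Yc] .
      show "(c \<union> Y r) \<inter> L j = {}" using r(2) c(5) C_disjoint_L[OF jI] by blast
      show "(c \<union> Y r) \<inter> C j \<noteq> {}" using c(3,5) by blast
    qed
    then obtain i where i: "i \<in> J" "i \<noteq> j" "- C i \<inter> Y r \<noteq> {}" using not_hole[OF c(1) Yc] by blast
    have iI: "i \<in> I" using i J_subset by blast
    \<comment> \<open>Here the enlarged set is needed: connected, disjoint from \<open>L i\<close>
      and containing both \<open>L j\<close> and \<open>c\<close>, it drags \<open>c\<close> into
      \<open>C i\<close>. Hence \<open>- C i\<close> misses \<open>c\<close> and lies in a single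
      component of \<open>- c\<close>.\<close>
    have "L' j \<subseteq> C i"
    proof (rule subset_C[OF iI L'(3)])
      show "L' j \<inter> L i = {}" using L'(1)[OF iI] L'(2) iI jI i(2) by (fastforce simp: disjoint_family_on_def)
      show "L' j \<inter> C i \<noteq> {}" using L_subset_C[of j i] i j L'(1)[OF jI] L[OF jI] by blast
    qed
    then have "- C i \<subseteq> - c" using c(4) by blast
    then have "- C i \<subseteq> Y r"
      using components_maximal[OF Yc connected_Compl_C[OF iI]] i(3) by blast
    then show ?thesis using i by blast
  qed
  then obtain k where k: "\<And>r. r \<in> R \<Longrightarrow> L j \<inter> Y r = {} \<Longrightarrow> k r \<in> J \<and> k r \<noteq> j \<and> - C (k r) \<subseteq> Y r"
    by metis
  \<comment> \<open>At most one of the components meets the connected set \<open>L j\<close>; it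
    receives the index \<open>j\<close>, which \<open>k\<close> never takes.\<close>
  define k' where "k' = (\<lambda>r. if L j \<inter> Y r = {} then k r else j)"
  have "inj_on k' R"
  proof (rule inj_onI)
    fix r s assume rs: "r \<in> R" "s \<in> R" "k' r = k' s"
    show "r = s"
    proof (cases "L j \<inter> Y r = {}")
      case True
      then have "L j \<inter> Y s = {}" "k r = k s" using rs k[of r] by (auto simp: k'_def split: if_splits)
      then have "- C (k r) \<subseteq> Y r \<inter> Y s" "k r \<in> J" using k[of r] k[of s] rs True by auto
      moreover from this have "- C (k r) \<noteq> {}"
        using C_disjoint_L[of "k r"] L[of "k r"] J_subset by blast
      ultimately show ?thesis using Ysep rs by blast
    next
      case False
      have Ljc: "L j \<inter> c = {}" using c(5) C_disjoint_L[OF jI] by blast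
      have "L j \<inter> Y s \<noteq> {}" using False rs k[of s] by (auto simp: k'_def split: if_splits)
      moreover have "L j \<subseteq> Y q" if "q \<in> R" "L j \<inter> Y q \<noteq> {}" for q
      proof -
        have "q \<notin> c" using that R(2) by (auto simp: separated_points_def)
        then have "Y q \<in> components (- c)" by (simp add: Y_def componentsI)
        then show ?thesis using components_maximal[of "Y q" "- c" "L j"] L[OF jI] Ljc that by blast
      qed
      ultimately show ?thesis using Ysep rs False by blast
    qed
  qed
  moreover have "k' ` R \<subseteq> I" using k J_subset jI by (auto simp: k'_def)
  ultimately show ?thesis using finite_I card_inj_on_le by blast
qed

end

text \<open>Index 0 is reserved for the identity, so that \<open>K\<close> and its images under the
  given maps form one family indexed by \<open>{..N}\<close>.\<close>

locale injective_self_maps =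
  fixes \<Omega> :: "complex set" and N :: nat and \<phi> :: "nat \<Rightarrow> complex \<Rightarrow> complex"
  assumes open_\<Omega>: "open \<Omega>" and connected_\<Omega>: "connected \<Omega>" and \<Omega>_ne: "\<Omega> \<noteq> {}"
    and N: "N \<ge> 1"
    and holo: "\<And>i. i \<le> N \<Longrightarrow> \<phi> i holomorphic_on \<Omega>"
    and into: "\<And>i. i \<le> N \<Longrightarrow> \<phi> i ` \<Omega> \<subseteq> \<Omega>"
    and inj: "\<And>i. i \<le> N \<Longrightarrow> inj_on (\<phi> i) \<Omega>"
    and \<phi>_0: "\<phi> 0 = id"
begin

abbreviation \<Phi> :: "nat \<Rightarrow> nat \<Rightarrow> complex \<Rightarrow> complex" where "\<Phi> i n \<equiv> \<phi> i ^^ n"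

section \<open>Iterates of injective holomorphic self-maps\<close>

lemma \<Phi>_0: "\<Phi> 0 n = id" by (simp add: \<phi>_0)

lemma \<Phi>_into: "i \<le> N \<Longrightarrow> \<Phi> i n ` \<Omega> \<subseteq> \<Omega>"
  using into by (induction n) auto

lemma \<Phi>_holo: "i \<le> N \<Longrightarrow> \<Phi> i n holomorphic_on \<Omega>"
proof (induction n)
  case (Suc n)
  have "(\<phi> i \<circ> \<Phi> i n) holomorphic_on \<Omega>"
    using Suc holomorphic_on_compose_gen[OF _ holo \<Phi>_into] by blast
  then show ?case by (simp only: funpow.simps)
qed (simp add: id_def)

lemma \<Phi>_inj: "i \<le> N \<Longrightarrow> inj_on (\<Phi> i n) \<Omega>"
proof (induction n)
  case (Suc n)
  have "inj_on (\<phi> i \<circ> \<Phi> i n) \<Omega>"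
    using Suc inj[OF Suc.prems] \<Phi>_into[OF Suc.prems] by (intro comp_inj_on) (auto intro: inj_on_subset)
  then show ?case by (simp only: funpow.simps)
qed simp

lemma compact_image_\<Phi>: "i \<le> N \<Longrightarrow> compact K \<Longrightarrow> K \<subseteq> \<Omega> \<Longrightarrow> compact (\<Phi> i n ` K)"
  by (meson \<Phi>_holo compact_continuous_image continuous_on_subset holomorphic_on_imp_continuous_on)

lemma connected_image_\<Phi>: "i \<le> N \<Longrightarrow> connected K \<Longrightarrow> K \<subseteq> \<Omega> \<Longrightarrow> connected (\<Phi> i n ` K)"
  by (meson \<Phi>_holo connected_continuous_image continuous_on_subset holomorphic_on_imp_continuous_on)

definition good :: "complex set \<Rightarrow> nat \<Rightarrow> bool" where
  "good K n \<longleftrightarrow> (\<forall>i\<le>N. convex_relative \<Omega> (\<Phi> i n ` K)) \<and> disjoint_family_on (\<lambda>i. \<Phi> i n ` K) {..N}"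

lemma good_subset:
  assumes "good K' n" "convex_relative \<Omega> K'" "convex_relative \<Omega> K" "K \<subseteq> K'"
  shows "good K n"
proof -
  have "K' \<subseteq> \<Omega>" using assms(2) by (simp add: convex_relative_iff)
  then have "convex_relative \<Omega> (\<Phi> i n ` K)" if "i \<le> N" for i
    using convex_relative_image_subset[OF \<Phi>_holo[OF that] open_\<Omega> \<Phi>_inj[OF that] assms(3,4), of n] assms(1) that
    by (simp add: good_def)
  moreover have "disjoint_family_on (\<lambda>i. \<Phi> i n ` K) {..N}"
    using assms(1,4) unfolding good_def disjoint_family_on_def by blast
  ultimately show ?thesis by (simp add: good_def)
qed

text \<open>Otherwise there are exhausting \<open>X t\<close> and good times \<open>n t > t\<close> at which the union has a hole in \<open>\<Omega>\<close>.
  Pigeonholing the index set \<open>J t\<close> of the images facing that hole and the components \<open>H t i\<close> of \<open>\<Omega> - K\<close>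
  through which they face it, three times \<open>t1, t2, t3\<close> with the same data suffice. If \<open>0 \<in> J t1\<close>, an image
  of \<open>K\<close> facing \<open>K\<close> at time \<open>n t1\<close> lies in \<open>H t2 0\<close> and in \<open>X t2\<close>. Otherwise all images at time \<open>n t2\<close>
  lie in one component \<open>Z\<close> of \<open>- X t2\<close>, which forces \<open>\<Phi> j (n t2 - n t1) ` K \<subseteq> H t3 j\<close> for some \<open>j\<close>. Both
  contradict the bound on separated points.\<close>

lemma eventually_union_convex_relative:
  assumes K: "convex_relative \<Omega> K" "connected K" "K \<noteq> {}"
    and R: "R \<subseteq> \<Omega>" "finite R" "card R = N + 2" "separated_points K R"
  shows "\<exists>K'. convex_relative \<Omega> K' \<and> K \<subseteq> K' \<and>
           (\<forall>n. good K' n \<longrightarrow> convex_relative \<Omega> (\<Union>i\<le>N. \<Phi> i n ` K))"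
proof (rule ccontr)
  assume neg: "\<not> ?thesis"
  have K1: "compact K" "K \<subseteq> \<Omega>" using K by (auto simp: convex_relative_iff)
  have "\<exists>K'. convex_relative \<Omega> K' \<and> connected K' \<and> K \<subseteq> K' \<and> (\<forall>i\<le>N. \<forall>s\<le>t. \<Phi> i s ` K \<subseteq> K')" for t
  proof -
    have "compact (K \<union> (\<Union>i\<le>N. \<Union>s\<le>t. \<Phi> i s ` K))"
      using compact_image_\<Phi> K1 by (intro compact_Un compact_UN) auto
    moreover have "\<Phi> i s ` K \<subseteq> \<Omega>" if "i \<le> N" for i s using \<Phi>_into[OF that, of s] K1 by blast
    then have "K \<union> (\<Union>i\<le>N. \<Union>s\<le>t. \<Phi> i s ` K) \<subseteq> \<Omega>" using K1 by blast
    ultimately obtain K' where "convex_relative \<Omega> K'" "connected K'" "K \<union> (\<Union>i\<le>N. \<Union>s\<le>t. \<Phi> i s ` K) \<subseteq> K'"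
      using convex_relative_hull[OF open_\<Omega> connected_\<Omega> \<Omega>_ne] by metis
    then show ?thesis by (intro exI[of _ K']) blast
  qed
  then obtain X where X: "\<And>t. convex_relative \<Omega> (X t)" "\<And>t. connected (X t)" "\<And>t. K \<subseteq> X t"
    "\<And>t i s. i \<le> N \<Longrightarrow> s \<le> t \<Longrightarrow> \<Phi> i s ` K \<subseteq> X t"
    by metis
  have "\<exists>n. good (X t) n \<and> \<not> convex_relative \<Omega> (\<Union>i\<le>N. \<Phi> i n ` K)" for t
    using neg X(1,3)[of t] by blast
  then obtain n where n: "\<And>t. good (X t) (n t)" "\<And>t. \<not> convex_relative \<Omega> (\<Union>i\<le>N. \<Phi> i (n t) ` K)"
    by metis
  have goodK: "good K (n t)" for t using good_subset[OF n(1) X(1) K(1) X(3)] .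
  have X_sub: "X t \<subseteq> \<Omega>" for t using X(1) by (simp add: convex_relative_iff)
  have X_disj: "\<Phi> i (n t) ` X t \<inter> \<Phi> j (n t) ` X t = {}" if "i \<le> N" "j \<le> N" "i \<noteq> j" for i j t
    using n(1)[of t] that by (auto simp: good_def disjoint_family_on_def)
  have n_gt: "t < n t" for t
  proof (rule ccontr)
    assume "\<not> t < n t"
    then have "\<Phi> 1 (n t) ` K \<subseteq> \<Phi> 0 (n t) ` X t" using X(4)[of 1 "n t" t] N by (simp add: \<Phi>_0)
    moreover have "\<Phi> 1 (n t) ` K \<subseteq> \<Phi> 1 (n t) ` X t" using X(3) by blast
    moreover have "\<Phi> 0 (n t) ` X t \<inter> \<Phi> 1 (n t) ` X t = {}" using X_disj[of 0 1 t] N by simp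
    ultimately have "\<Phi> 1 (n t) ` K = {}" by blast
    then show False using K(3) by simp
  qed
  have "\<exists>x. junction \<Omega> {..N} (\<lambda>i. \<Phi> i (n t) ` K) x" for t
  proof -
    have Lc: "convex_relative \<Omega> (\<Phi> i (n t) ` K)" if "i \<le> N" for i
      using goodK[of t] that by (simp add: good_def)
    then have "compact (\<Union>i\<le>N. \<Phi> i (n t) ` K)" "(\<Union>i\<le>N. \<Phi> i (n t) ` K) \<subseteq> \<Omega>"
      by (auto intro!: compact_UN simp: convex_relative_iff)
    then obtain B where B: "B \<in> components (- (\<Union>i\<le>N. \<Phi> i (n t) ` K))" "bounded B" "B \<subseteq> \<Omega>"
      using n(2)[of t] unfolding convex_relative_iff by blast
    then obtain x where x: "x \<in> - (\<Union>i\<le>N. \<Phi> i (n t) ` K)"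
      "B = connected_component_set (- (\<Union>i\<le>N. \<Phi> i (n t) ` K)) x"
      by (auto simp: components_iff)
    have "junction \<Omega> {..N} (\<lambda>i. \<Phi> i (n t) ` K) x"
    proof
      show "convex_relative \<Omega> (\<Phi> i (n t) ` K) \<and> connected (\<Phi> i (n t) ` K) \<and> \<Phi> i (n t) ` K \<noteq> {}"
        if "i \<in> {..N}" for i
        using that Lc connected_image_\<Phi> K K1 by auto
      show "disjoint_family_on (\<lambda>i. \<Phi> i (n t) ` K) {..N}" using goodK by (simp add: good_def)
    qed (use x B in auto)
    then show ?thesis by blast
  qed
  then obtain x where jun: "\<And>t. junction \<Omega> {..N} (\<lambda>i. \<Phi> i (n t) ` K) (x t)" by metis
  define L where "L = (\<lambda>t i. \<Phi> i (n t) ` K)"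
  define C where "C = (\<lambda>t. junction.C (L t) (x t))"
  define J where "J = (\<lambda>t. junction.J {..N} (L t) (x t))"
  have junL: "junction \<Omega> {..N} (L t) (x t)" for t using jun by (simp add: L_def)
  have JD: "junction.J {..N} (L t) (x t) = J t" and CD: "junction.C (L t) (x t) = C t" for t
    by (simp_all add: J_def C_def)
  have JN: "J t \<subseteq> {..N}" for t using junction.J_subset[OF junL] by (simp add: J_def)
  \<comment> \<open>The side facing the hole, pulled back to \<open>\<Omega> - K\<close>, where
    different times can be compared. By \<open>H_fin\<close> only finitely many values
    occur.\<close>
  define H where "H = (\<lambda>t i. {y \<in> \<Omega> - K. \<Phi> i (n t) y \<in> C t i})"
  have few: False
    if "j \<in> J t" "i \<le> N" "s \<le> t" "\<Phi> i s ` K \<subseteq> H t j" "convex_relative \<Omega> (\<Phi> i s ` K)" for i j s t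
  proof -
    have jN: "j \<le> N" using that(1) JN by blast
    have holo': "(\<Phi> j (n t) \<circ> \<Phi> i s) holomorphic_on \<Omega>"
      using holomorphic_on_compose_gen[OF \<Phi>_holo[OF that(2)] \<Phi>_holo[OF jN] \<Phi>_into[OF that(2)]] .
    have inj': "inj_on (\<Phi> j (n t) \<circ> \<Phi> i s) \<Omega>"
      using comp_inj_on[OF \<Phi>_inj[OF that(2)] inj_on_subset[OF \<Phi>_inj[OF jN] \<Phi>_into[OF that(2)]]] .
    have sub: "\<Phi> i s ` K \<subseteq> X t" using X(4) that by blast
    have "card ((\<Phi> j (n t) \<circ> \<Phi> i s) ` R) \<le> card {..N}"
    proof (rule junction.few_separated_points[OF junL, where j = j and L' = "\<lambda>i. \<Phi> i (n t) ` X t"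
            and c = "(\<Phi> j (n t) \<circ> \<Phi> i s) ` K"])
      show "j \<in> junction.J {..N} (L t) (x t)" using that(1) by (simp add: J_def)
      show "L t k \<subseteq> \<Phi> k (n t) ` X t" for k using X(3) by (auto simp: L_def)
      show "disjoint_family_on (\<lambda>i. \<Phi> i (n t) ` X t) {..N}" using n(1) by (simp add: good_def)
      show "connected (\<Phi> j (n t) ` X t)" using connected_image_\<Phi>[OF jN X(2) X_sub] .
      show "convex_relative \<Omega> ((\<Phi> j (n t) \<circ> \<Phi> i s) ` K)"
        using convex_relative_image_subset[OF \<Phi>_holo[OF jN] open_\<Omega> \<Phi>_inj[OF jN] that(5) sub X_sub] n(1) jN
        by (simp add: good_def image_comp)
      show "connected ((\<Phi> j (n t) \<circ> \<Phi> i s) ` K)"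
        using connected_continuous_image[OF _ K(2)] holo' K1(2)
        by (meson continuous_on_subset holomorphic_on_imp_continuous_on)
      show "(\<Phi> j (n t) \<circ> \<Phi> i s) ` K \<subseteq> \<Phi> j (n t) ` X t" using sub by auto
      show "(\<Phi> j (n t) \<circ> \<Phi> i s) ` K \<subseteq> junction.C (L t) (x t) j"
        using that(4) by (auto simp: H_def C_def)
      show "separated_points ((\<Phi> j (n t) \<circ> \<Phi> i s) ` K) ((\<Phi> j (n t) \<circ> \<Phi> i s) ` R)"
        using separated_points_image[OF open_\<Omega> connected_\<Omega> K1 R(1) holo' inj' R(4)] .
    qed (use K(3) R(2) in auto)
    moreover have "card ((\<Phi> j (n t) \<circ> \<Phi> i s) ` R) = N + 2"
      using R(1,3) inj' by (metis card_image inj_on_subset)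
    ultimately show False by simp
  qed
  have H_fin: "H t i \<in> insert {} ((\<lambda>A. \<Omega> \<inter> A) ` components (- K))" if i: "i \<le> N" for t i
  proof (cases "H t i = {}")
    case False
    then obtain y where y: "y \<in> \<Omega>" "y \<notin> K" "\<Phi> i (n t) y \<in> C t i" by (auto simp: H_def)
    have "z \<in> H t i \<longleftrightarrow> z \<in> \<Omega> \<inter> connected_component_set (- K) y" for z
    proof (cases "z \<in> \<Omega> - K")
      case True
      have "\<Phi> i (n t) z \<in> C t i \<longleftrightarrow> connected_component (- L t i) (\<Phi> i (n t) y) (\<Phi> i (n t) z)"
        using y(3) unfolding C_def junction.C_def[OF junL]
        by (metis connected_component_eq mem_Collect_eq)
      then show ?thesis
        using connected_component_image_iff[OF open_\<Omega> connected_\<Omega> K1 y(1) _ \<Phi>_holo[OF i] \<Phi>_inj[OF i], of z "n t"] True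
        by (simp add: H_def L_def)
    next
      case False
      then show ?thesis using connected_component_in by (fastforce simp: H_def)
    qed
    then have "H t i = \<Omega> \<inter> connected_component_set (- K) y" by blast
    moreover have "connected_component_set (- K) y \<in> components (- K)" using y by (simp add: componentsI)
    ultimately show ?thesis by blast
  qed auto
  define D where "D = (\<lambda>t. (J t, restrict (H t) {..N}))"
  have "finite (range D)"
  proof (rule finite_subset)
    show "range D \<subseteq> Pow {..N} \<times> (PiE {..N} (\<lambda>_. insert {} ((\<lambda>A. \<Omega> \<inter> A) ` components (- K))))"
    proof
      fix d assume "d \<in> range D"
      then obtain t where "d = D t" by blast
      moreover have "restrict (H t) {..N} \<in> PiE {..N} (\<lambda>_. insert {} ((\<lambda>A. \<Omega> \<inter> A) ` components (- K)))"
        using H_fin by (intro restrict_PiE_iff[THEN iffD2]) blast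
      ultimately show "d \<in> Pow {..N} \<times> (PiE {..N} (\<lambda>_. insert {} ((\<lambda>A. \<Omega> \<inter> A) ` components (- K))))"
        using JN by (simp add: D_def)
    qed
    show "finite (Pow {..N} \<times> (PiE {..N} (\<lambda>_. insert {} ((\<lambda>A. \<Omega> \<inter> A) ` components (- K)))))"
      using finite_components_convex_relative[OF K(1) open_\<Omega>] by (intro finite_SigmaI finite_PiE) auto
  qed
  then obtain t1 where inf: "infinite {t. D t = D t1}"
    using pigeonhole_infinite[of UNIV D] by auto
  \<comment> \<open>The spacing \<open>n t1 \<le> t2\<close> and \<open>n t2 \<le> t3\<close>
    ensures that images of \<open>K\<close> at times up to \<open>n t1\<close> lie in
    \<open>X t2\<close>, and those up to \<open>n t2\<close> in \<open>X t3\<close>.\<close>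
  obtain t2 where t2: "D t2 = D t1" "n t1 \<le> t2"
    using inf unfolding infinite_nat_iff_unbounded_le by blast
  obtain t3 where t3: "D t3 = D t1" "n t2 \<le> t3"
    using inf unfolding infinite_nat_iff_unbounded_le by blast
  have Jeq: "J t2 = J t1" "J t3 = J t1" using t2 t3 by (auto simp: D_def)
  have "H t i = snd (D t) i" if "i \<le> N" for i t using that by (simp add: D_def)
  then have Heq: "H t2 i = H t1 i" "H t3 i = H t1 i" if "i \<le> N" for i
    using t2(1) t3(1) that by metis+
  note J_other = junction.J_other[OF junL, unfolded JD]
  note L_subset_C = junction.L_subset_C[OF junL, unfolded JD CD]
  note C_disjoint_L = junction.C_disjoint_L[OF junL, unfolded CD]
  show False
  proof (cases "0 \<in> J t1")
    case True
    obtain j where j: "j \<in> J t1" "j \<noteq> 0" using J_other[OF True] by blast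
    then have jN: "j \<le> N" using JN by blast
    have sub: "\<Phi> j (n t1) ` K \<subseteq> C t1 0" using L_subset_C[OF j(1) True j(2)] by (simp add: L_def)
    have "C t1 0 \<inter> K = {}" using C_disjoint_L[of 0 t1] by (simp add: L_def \<Phi>_0)
    moreover have "\<Phi> j (n t1) ` K \<subseteq> \<Omega>" using \<Phi>_into[OF jN, of "n t1"] K1 by blast
    ultimately have "\<Phi> j (n t1) ` K \<subseteq> H t1 0" using sub by (auto simp: H_def \<Phi>_0)
    then have "\<Phi> j (n t1) ` K \<subseteq> H t2 0" using Heq(1)[of 0] by simp
    moreover have "convex_relative \<Omega> (\<Phi> j (n t1) ` K)" using goodK jN by (simp add: good_def)
    ultimately show False using few[of 0 t2 j "n t1"] True Jeq jN t2 by simp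
  next
    case False
    obtain j0 where j0: "j0 \<in> J t2" "L t2 0 \<inter> C t2 j0 = {}"
      using junction.L_outside[OF junL, of 0 t2, unfolded JD CD] False Jeq by auto
    have j0N: "j0 \<le> N" "j0 \<noteq> 0" using j0 JN False Jeq by auto
    have C0: "C t2 j0 \<in> components (- L t2 j0)" "x t2 \<in> C t2 j0"
      using junction.C_component[OF junL] junction.x_in_C[OF junL] j0N by (auto simp: C_def)
    have XL: "X t2 \<inter> L t2 j0 = {}"
      using X_disj[of 0 j0 t2] j0N X(3)[of t2] unfolding L_def \<Phi>_0 by auto
    \<comment> \<open>\<open>X t2\<close> is connected and misses \<open>L t2 j0\<close>, so it lies
      either inside or outside \<open>C t2 j0\<close>. It contains \<open>K = L t2 0\<close>, which
      is outside.\<close>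
    have XC: "X t2 \<inter> C t2 j0 = {}"
    proof (rule ccontr)
      assume "X t2 \<inter> C t2 j0 \<noteq> {}"
      then have "X t2 \<subseteq> C t2 j0" using components_maximal[OF C0(1) X(2)[of t2]] XL by blast
      then show False using j0(2) X(3)[of t2] K(3) by (auto simp: L_def \<Phi>_0)
    qed
    define Z where "Z = connected_component_set (- X t2) (x t2)"
    have "x t2 \<in> - X t2" using C0 XC by blast
    then have Z: "Z \<in> components (- X t2)" "x t2 \<in> Z" by (auto simp: Z_def componentsI)
    have "L t2 j0 \<union> C t2 j0 \<subseteq> Z"
    proof (rule components_maximal[OF Z(1)])
      have "closed (L t2 j0)" "connected (L t2 j0)"
        using compact_imp_closed[OF junction.compact_L[OF junL, of j0 t2]] junction.L[OF junL, of j0 t2] j0N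
        by auto
      then show "connected (L t2 j0 \<union> C t2 j0)" using connected_Un_component C0 by blast
      show "L t2 j0 \<union> C t2 j0 \<subseteq> - X t2" using XL XC by blast
      show "Z \<inter> (L t2 j0 \<union> C t2 j0) \<noteq> {}" using Z C0 by blast
    qed
    then have LZ: "L t2 j \<subseteq> Z" if "j \<in> J t2" for j
      using L_subset_C[OF that j0(1)] by (cases "j = j0") auto
    \<comment> \<open>\<open>X t2\<close> is \<Omega>-convex, so its component \<open>Z\<close> must
      stick out of some \<open>C t1 i\<close>. Since \<open>L t1 i\<close> lies in
      \<open>X t2\<close>, the connected set \<open>Z\<close> avoids it and hence lies entirely on
      the far side, which every other \<open>C t1 j\<close> contains.\<close>
    obtain i where i: "i \<in> J t1" "\<not> Z \<subseteq> C t1 i"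
      using junction.not_hole[OF junL X(1) Z(1), of t1, unfolded JD CD] by blast
    have iN: "i \<le> N" using i JN by blast
    have "Z \<inter> L t1 i = {}" using in_components_subset[OF Z(1)] X(4)[OF iN t2(2)] by (auto simp: L_def)
    then have Zi: "Z \<subseteq> - C t1 i"
      using junction.subset_C[OF junL, of i Z t1, unfolded CD] in_components_connected[OF Z(1)] i(2) iN
      by blast
    obtain j where j: "j \<in> J t1" "j \<noteq> i" using J_other[OF i(1)] by blast
    have jN: "j \<le> N" using j JN by blast
    have "- C t1 i \<subseteq> C t1 j"
      using junction.Compl_C_subset[OF junL, unfolded JD CD, OF i(1) j(1)] j(2) by blast
    then have LC: "L t2 j \<subseteq> C t1 j" using LZ[of j] j(1) Jeq Zi by blast
    \<comment> \<open>The subtraction is genuine, since \<open>n t1 \<le> t2 < n t2\<close>.\<close>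
    define s where "s = n t2 - n t1"
    have s: "n t2 = n t1 + s" "s \<le> t3" using n_gt[of t2] t2 t3 by (auto simp: s_def)
    have L2: "L t2 j = \<Phi> j (n t1) ` \<Phi> j s ` K"
      unfolding L_def s(1) funpow_add by (simp only: image_comp)
    have sub: "\<Phi> j s ` K \<subseteq> \<Omega>" using \<Phi>_into[OF jN, of s] K1 by blast
    have "\<Phi> j s ` K \<subseteq> H t3 j"
      unfolding Heq(2)[OF jN]
    proof
      fix y assume y: "y \<in> \<Phi> j s ` K"
      then have yC: "\<Phi> j (n t1) y \<in> C t1 j" using LC L2 by blast
      then have "y \<notin> K" using C_disjoint_L[of j t1] jN by (auto simp: L_def)
      then show "y \<in> H t1 j" using y yC sub by (auto simp: H_def)
    qed
    \<comment> \<open>The time \<open>s\<close> itself need not be good; convexity is pulled back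
      through \<open>\<Phi> j (n t1)\<close> from the good time \<open>n t2\<close>.\<close>
    moreover have "convex_relative \<Omega> (\<Phi> j s ` K)"
    proof (rule convex_relative_if_image[OF \<Phi>_holo[OF jN] open_\<Omega> \<Phi>_inj[OF jN] \<Phi>_into[OF jN] _ sub])
      show "compact (\<Phi> j s ` K)" using compact_image_\<Phi>[OF jN K1] .
      show "convex_relative \<Omega> (\<Phi> j (n t1) ` \<Phi> j s ` K)"
        using goodK[of t2] jN unfolding L2[symmetric] by (simp add: good_def L_def)
    qed
    ultimately show False using few[of j t3 j s] j(1) Jeq jN s(2) by simp
  qed
qed

end

section \<open>Disjoint transitivity\<close>

lemma composition_operator_funpow:
  assumes f: "f \<in> holomorphic_functions \<Omega>" and im: "\<phi> ` \<Omega> \<subseteq> \<Omega>"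
  shows "(composition_operator \<Omega> \<phi> ^^ n) f = restrict (f \<circ> (\<phi> ^^ n)) \<Omega>"
proof (induction n)
  case 0
  then show ?case using f by (simp add: holomorphic_functions_def extensional_restrict)
next
  case (Suc n)
  have "(composition_operator \<Omega> \<phi> ^^ Suc n) f = composition_operator \<Omega> \<phi> (restrict (f \<circ> (\<phi> ^^ n)) \<Omega>)"
    by (simp only: funpow.simps comp_apply[of _ _ f] Suc.IH)
  also have "\<dots> = restrict (restrict (f \<circ> (\<phi> ^^ n)) \<Omega> \<circ> \<phi>) \<Omega>"
    by (simp only: composition_operator_def)
  also have "\<dots> = restrict (f \<circ> (\<phi> ^^ Suc n)) \<Omega>"
    using im by (intro restrict_ext) (auto simp: funpow_swap1)
  finally show ?case .
qed

text \<open>On a compact non-empty \<open>K\<close> the distance attains its maximum, so the strict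
  bound leaves a uniform margin \<delta>.\<close>

lemma openin_holomorphic_nhd:
  assumes g: "g holomorphic_on \<Omega>" and K: "compact K" "K \<subseteq> \<Omega>"
  shows "openin (holomorphic_topology \<Omega>) (holomorphic_nhd \<Omega> g K \<epsilon>)"
  unfolding openin_holomorphic_topology
proof (intro conjI ballI)
  show "holomorphic_nhd \<Omega> g K \<epsilon> \<subseteq> holomorphic_functions \<Omega>" by (auto simp: holomorphic_nhd_def)
  fix f assume f: "f \<in> holomorphic_nhd \<Omega> g K \<epsilon>"
  have "\<exists>\<delta>>0. \<forall>z\<in>K. dist (f z) (g z) + \<delta> \<le> \<epsilon>"
  proof (cases "K = {}")
    case False
    have "f holomorphic_on \<Omega>" using f by (simp add: holomorphic_nhd_def holomorphic_functions_def)
    then have "continuous_on K f" "continuous_on K g"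
      using g K(2) by (meson holomorphic_on_imp_continuous_on continuous_on_subset)+
    then have "continuous_on K (\<lambda>z. dist (f z) (g z))" by (intro continuous_intros)
    from continuous_attains_sup[OF K(1) False this]
    obtain z0 where z0: "z0 \<in> K" "\<And>z. z \<in> K \<Longrightarrow> dist (f z) (g z) \<le> dist (f z0) (g z0)" by blast
    then show ?thesis using f by (intro exI[of _ "\<epsilon> - dist (f z0) (g z0)"]) (auto simp: holomorphic_nhd_def)
  qed (auto intro: exI[of _ 1])
  then obtain \<delta> where \<delta>: "\<delta> > 0" "\<And>z. z \<in> K \<Longrightarrow> dist (f z) (g z) + \<delta> \<le> \<epsilon>" by blast
  have "holomorphic_nhd \<Omega> f K \<delta> \<subseteq> holomorphic_nhd \<Omega> g K \<epsilon>"
  proof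
    fix h assume h: "h \<in> holomorphic_nhd \<Omega> f K \<delta>"
    have "dist (h z) (g z) < \<epsilon>" if "z \<in> K" for z
      using h that \<delta>(2)[OF that] dist_triangle[of "h z" "g z" "f z"] by (fastforce simp: holomorphic_nhd_def)
    then show "h \<in> holomorphic_nhd \<Omega> g K \<epsilon>" using h by (simp add: holomorphic_nhd_def)
  qed
  then show "\<exists>K' \<delta>. compact K' \<and> K' \<subseteq> \<Omega> \<and> \<delta> > 0 \<and> holomorphic_nhd \<Omega> f K' \<delta> \<subseteq> holomorphic_nhd \<Omega> g K \<epsilon>"
    using K \<delta>(1) by blast
qed

text \<open>Adjoining a finite set \<open>Q\<close> to \<open>K\<close> keeps \<Omega>-convexity,
  since an open connected plane set minus finitely many points stays connected. Runge's theorem then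
  applies to the function equal to 0 near \<open>K\<close> and 5 near \<open>Q\<close>.\<close>

lemma function_large_on_complementary_components:
  assumes K: "convex_relative \<Omega> K" "K \<noteq> {}" and \<Omega>: "open \<Omega>"
  obtains h L where "h holomorphic_on \<Omega>" "compact L" "K \<subseteq> L" "L \<subseteq> \<Omega>"
    "\<And>z. z \<in> K \<Longrightarrow> norm (h z) < 1" "\<And>C. C \<in> components (- K) \<Longrightarrow> \<exists>q\<in>C \<inter> L. norm (h q - 5) < 1"
proof -
  have K1: "compact K" "K \<subseteq> \<Omega>" using K by (auto simp: convex_relative_iff)
  have clK: "closed K" using K1 compact_imp_closed by blast
  have "\<exists>q. q \<in> C \<inter> \<Omega>" if "C \<in> components (- K)" for C
    using component_meets_open[OF clK K(2) K1(2) \<Omega> that] by blast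
  then obtain q where q: "\<And>C. C \<in> components (- K) \<Longrightarrow> q C \<in> C \<inter> \<Omega>" by metis
  define Q where "Q = q ` components (- K)"
  have "finite Q" using finite_components_convex_relative[OF K(1) \<Omega>] by (simp add: Q_def)
  have Q: "Q \<subseteq> \<Omega>" "Q \<inter> K = {}"
    using q in_components_subset unfolding Q_def by blast+
  have cvx: "convex_relative \<Omega> (K \<union> Q)"
    unfolding convex_relative_iff
  proof (intro conjI ballI impI notI)
    fix D assume D: "D \<in> components (- (K \<union> Q))" "bounded D" "D \<subseteq> \<Omega>"
    obtain z where z: "z \<in> D" using in_components_nonempty[OF D(1)] by blast
    then have zK: "z \<in> - K" "z \<notin> Q" using in_components_subset[OF D(1)] by auto
    define C where "C = connected_component_set (- K) z"
    have C: "C \<in> components (- K)" "z \<in> C" using zK by (auto simp: C_def componentsI)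
    have "connected (C - Q)"
      using connected_open_delete_finite[of C Q] open_components[OF _ C(1)] in_components_connected[OF C(1)]
        \<open>finite Q\<close> clK by (simp add: open_Compl)
    then have "C - Q \<subseteq> D"
      using components_maximal[OF D(1), of "C - Q"] in_components_subset[OF C(1)] C(2) z zK by blast
    then have "C \<subseteq> D \<union> Q" by blast
    moreover have "bounded (D \<union> Q)" using D(2) \<open>finite Q\<close> finite_imp_bounded by simp
    ultimately have "bounded C" "C \<subseteq> \<Omega>" using bounded_subset D(3) Q(1) by blast+
    then show False using K(1) C(1) unfolding convex_relative_iff by blast
  qed (use K1 Q \<open>finite Q\<close> in \<open>auto intro: compact_Un finite_imp_compact\<close>)
  obtain U V where UV: "open U" "open V" "K \<subseteq> U" "Q \<subseteq> V" "U \<inter> V = {}"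
    using separation_normal_compact[OF K1(1) finite_imp_closed[OF \<open>finite Q\<close>]] Q(2) by (metis Int_commute)
  define F where "F = (\<lambda>z. if z \<in> V then 5 else 0 :: complex)"
  have "F holomorphic_on U" by (rule holomorphic_transform[of "\<lambda>_. 0"]) (use UV(5) in \<open>auto simp: F_def\<close>)
  moreover have "F holomorphic_on V" by (rule holomorphic_transform[of "\<lambda>_. 5"]) (auto simp: F_def)
  ultimately have "F holomorphic_on U \<union> V" using UV(1,2) by (intro holomorphic_on_Un) auto
  then have "approximable \<Omega> (K \<union> Q) F" using runge[OF cvx, of "U \<union> V" F] UV by auto
  from this[unfolded approximable_def, rule_format, of 1]
  obtain h where h: "h holomorphic_on \<Omega>" "\<And>z. z \<in> K \<union> Q \<Longrightarrow> norm (h z - F z) < 1" by auto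
  show ?thesis
  proof (rule that[OF h(1), of "K \<union> Q"])
    show "compact (K \<union> Q)" using cvx by (simp add: convex_relative_iff)
    fix z assume z: "z \<in> K"
    then have "z \<notin> V" using UV by blast
    then show "norm (h z) < 1" using h(2)[of z] z by (simp add: F_def)
  next
    fix C assume C: "C \<in> components (- K)"
    then have "q C \<in> C \<inter> (K \<union> Q)" "q C \<in> V" using q UV(4) by (auto simp: Q_def)
    then show "\<exists>q\<in>C \<inter> (K \<union> Q). norm (h q - 5) < 1" using h(2)[of "q C"] by (auto simp: F_def)
  qed (use K1 Q in auto)
qed

text \<open>By the maximum principle \<open>f - c\<close> would stay bounded by 2 on a hole of \<open>\<psi> ` K\<close> filled by \<open>\<Omega>\<close>,
  but such a hole contains the image under \<open>\<psi>\<close> of a point where \<open>h\<close> is close to 5.\<close>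

lemma convex_relative_image_if_approximation:
  assumes \<Omega>: "open \<Omega>" "connected \<Omega>" and K: "convex_relative \<Omega> K" "K \<noteq> {}"
    and \<psi>: "\<psi> holomorphic_on \<Omega>" "inj_on \<psi> \<Omega>" "\<psi> ` \<Omega> \<subseteq> \<Omega>"
    and L: "K \<subseteq> L" "L \<subseteq> \<Omega>"
    and h: "\<And>z. z \<in> K \<Longrightarrow> norm (h z) < 1" "\<And>C. C \<in> components (- K) \<Longrightarrow> \<exists>q\<in>C \<inter> L. norm (h q - 5) < 1"
    and f: "f holomorphic_on \<Omega>" "\<And>z. z \<in> L \<Longrightarrow> norm (f (\<psi> z) - (h z + c)) < 1"
  shows "convex_relative \<Omega> (\<psi> ` K)"
  unfolding convex_relative_iff
proof (intro conjI ballI impI notI)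
  have K1: "compact K" "K \<subseteq> \<Omega>" using K by (auto simp: convex_relative_iff)
  have cont: "continuous_on \<Omega> \<psi>" using \<psi>(1) holomorphic_on_imp_continuous_on by blast
  show comp: "compact (\<psi> ` K)" using K1 cont by (meson compact_continuous_image continuous_on_subset)
  show sub: "\<psi> ` K \<subseteq> \<Omega>" using K1 \<psi>(3) by blast
  fix B assume B: "B \<in> components (- \<psi> ` K)" "bounded B" "B \<subseteq> \<Omega>"
  have clo: "closed (\<psi> ` K)" using comp compact_imp_closed by blast
  \<comment> \<open>The hole need not lie in the range of \<psi>, but its frontier lies in
    \<open>\<psi>\<close> K\<open>, inside the open set\<close>\<psi> \<open>\<Omega>\<close>. A
    point of \<Omega> mapped into \<open>B\<close> then determines which component of
    \<open>- K\<close> supplies \<open>q\<close>.\<close>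
  have "B \<inter> \<psi> ` \<Omega> \<noteq> {}"
    using component_meets_open[OF clo _ image_mono[OF K1(2)] open_mapping_thm3[OF \<psi>(1) \<Omega>(1) \<psi>(2)] B(1)] K(2)
    by blast
  then obtain x where x: "x \<in> \<Omega>" "\<psi> x \<in> B" by blast
  then have "x \<in> - K" using in_components_subset[OF B(1)] by blast
  then obtain q where q: "q \<in> L" "connected_component (- K) x q" "norm (h q - 5) < 1"
    using h(2)[OF componentsI] by blast
  have "connected_component (- \<psi> ` K) (\<psi> x) (\<psi> q)"
    using connected_component_image[OF \<Omega> K1 x(1) _ cont \<psi>(2) q(2)] q(1) L by blast
  then have qB: "\<psi> q \<in> B"
    using B(1) x(2) by (metis connected_component_eq components_iff mem_Collect_eq)
  have fr: "frontier B \<subseteq> \<psi> ` K" using frontier_of_components_closed_complement[OF clo B(1)] .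
  then have cl: "closure B \<subseteq> \<Omega>" using B(3) sub by (auto simp: closure_Un_frontier)
  have "norm (f (\<psi> q) - c) \<le> 2"
  proof (rule maximum_modulus_frontier[where f = "\<lambda>z. f z - c" and S = B])
    show "(\<lambda>z. f z - c) holomorphic_on interior B"
      using B(3) interior_subset[of B] by (intro holomorphic_intros holomorphic_on_subset[OF f(1)]) auto
    show "continuous_on (closure B) (\<lambda>z. f z - c)"
      using holomorphic_on_imp_continuous_on[OF f(1)] cl by (intro continuous_intros) (rule continuous_on_subset)
    fix z assume "z \<in> frontier B"
    then obtain k where k: "k \<in> K" "z = \<psi> k" using fr by blast
    have "f z - c = (f (\<psi> k) - (h k + c)) + h k" using k by simp
    then show "norm (f z - c) \<le> 2"
      using norm_triangle_ineq[of "f (\<psi> k) - (h k + c)" "h k"] f(2)[of k] h(1)[of k] k L(1)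
      by (smt (verit) subsetD)
  qed (use B qB in auto)
  moreover have "5 = norm (f (\<psi> q) - c - (f (\<psi> q) - (h q + c)) - (h q - 5))" by simp
  then have "5 \<le> norm (f (\<psi> q) - c) + norm (f (\<psi> q) - (h q + c)) + norm (h q - 5)"
    by (smt (verit) norm_triangle_ineq4)
  ultimately show False using f(2)[OF q(1)] q(3) by simp
qed

context injective_self_maps
begin

text \<open>On the i-th image the target is \<open>g i\<close> composed with the inverse of
  \<open>\<Phi> i n\<close>. These pieces fit together near the disjoint images, and Runge's theorem
  is applied to their union.\<close>

lemma simultaneous_approximation:
  assumes K: "convex_relative \<Omega> K" "K \<noteq> {}" and n: "good K n"
    and un: "convex_relative \<Omega> (\<Union>i\<le>N. \<Phi> i n ` K)"
    and g: "\<And>i. i \<le> N \<Longrightarrow> g i holomorphic_on \<Omega>" and \<epsilon>: "\<epsilon> > 0"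
  obtains h where "h holomorphic_on \<Omega>" "\<And>i z. i \<le> N \<Longrightarrow> z \<in> K \<Longrightarrow> norm (h (\<Phi> i n z) - g i z) < \<epsilon>"
proof -
  have K1: "compact K" "K \<subseteq> \<Omega>" using K by (auto simp: convex_relative_iff)
  define M where "M = (\<lambda>i. \<Phi> i n ` K)"
  have clM: "closed (M i)" if "i \<le> N" for i
    using compact_imp_closed[OF compact_image_\<Phi>[OF that K1]] by (simp add: M_def)
  have Mne: "M i \<noteq> {}" for i using K by (simp add: M_def)
  have dM: "M i \<inter> M j = {}" if "i \<le> N" "j \<le> N" "i \<noteq> j" for i j
    using n that by (auto simp: good_def disjoint_family_on_def M_def)
  have "\<exists>q. q holomorphic_on \<Phi> i n ` \<Omega> \<and> (\<forall>z\<in>\<Omega>. q (\<Phi> i n z) = z)" if "i \<le> N" for i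
    using holomorphic_has_inverse[OF \<Phi>_holo[OF that] open_\<Omega> \<Phi>_inj[OF that]] by metis
  then obtain q where q: "\<And>i. i \<le> N \<Longrightarrow> q i holomorphic_on \<Phi> i n ` \<Omega>"
    "\<And>i z. i \<le> N \<Longrightarrow> z \<in> \<Omega> \<Longrightarrow> q i (\<Phi> i n z) = z" by metis
  \<comment> \<open>Voronoi cells of the images: open, pairwise disjoint and containing the
    respective image. They are cut down to the range of \<open>\<Phi> j n\<close>, where the inverse
    \<open>q j\<close> exists.\<close>
  define V where "V = (\<lambda>j. (\<Inter>i\<in>{..N} - {j}. {z. infdist z (M j) < infdist z (M i)}) \<inter> \<Phi> j n ` \<Omega>)"
  have openV: "open (V j)" if "j \<le> N" for j
    unfolding V_def using open_mapping_thm3[OF \<Phi>_holo[OF that] open_\<Omega> \<Phi>_inj[OF that]]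
    by (intro open_Int open_INT ballI open_Collect_less continuous_intros) auto
  have Vdisj: "i = j" if "i \<le> N" "j \<le> N" "z \<in> V i" "z \<in> V j" for i j z
  proof (rule ccontr)
    assume "i \<noteq> j"
    then have "infdist z (M i) < infdist z (M j)" "infdist z (M j) < infdist z (M i)"
      using that by (auto simp: V_def)
    then show False by simp
  qed
  have MV: "M j \<subseteq> V j" if j: "j \<le> N" for j
  proof
    fix z assume z: "z \<in> M j"
    have "infdist z (M j) < infdist z (M i)" if "i \<le> N" "i \<noteq> j" for i
    proof -
      have "z \<notin> M i" using z dM[OF that(1) j that(2)] by blast
      then have "infdist z (M i) \<noteq> 0" using in_closed_iff_infdist_zero[OF clM[OF that(1)] Mne] by simp
      moreover have "infdist z (M j) = 0" using z by simp
      ultimately show ?thesis using infdist_nonneg[of z "M i"] by simp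
    qed
    moreover have "z \<in> \<Phi> j n ` \<Omega>" using z K1 by (auto simp: M_def)
    ultimately show "z \<in> V j" by (auto simp: V_def)
  qed
  define F where "F = (\<lambda>z. let j = (THE j. j \<le> N \<and> z \<in> V j) in g j (q j z))"
  have F: "F z = g j (q j z)" if "j \<le> N" "z \<in> V j" for j z
  proof -
    have "(THE j. j \<le> N \<and> z \<in> V j) = j" using that Vdisj by (intro the_equality) auto
    then show ?thesis by (simp add: F_def)
  qed
  have "F holomorphic_on V j" if j: "j \<le> N" for j
  proof -
    have "q j ` \<Phi> j n ` \<Omega> \<subseteq> \<Omega>" using q(2)[OF j] by auto
    then have "(g j \<circ> q j) holomorphic_on \<Phi> j n ` \<Omega>"
      using holomorphic_on_compose_gen[OF q(1)[OF j] g[OF j]] by blast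
    then have "(g j \<circ> q j) holomorphic_on V j" by (rule holomorphic_on_subset) (auto simp: V_def)
    then show ?thesis by (rule holomorphic_transform) (simp add: F[OF j])
  qed
  then have "F holomorphic_on (\<Union>j\<in>{..N}. V j)" using openV by (intro holomorphic_on_UN_open) auto
  moreover have "open (\<Union>j\<in>{..N}. V j)" using openV by auto
  moreover have "(\<Union>i\<le>N. \<Phi> i n ` K) \<subseteq> (\<Union>j\<in>{..N}. V j)"
    by (rule UN_mono) (use MV in \<open>auto simp: M_def\<close>)
  ultimately have "approximable \<Omega> (\<Union>i\<le>N. \<Phi> i n ` K) F" using runge[OF un] by blast
  from this[unfolded approximable_def, rule_format, OF \<epsilon>]
  obtain h where h: "h holomorphic_on \<Omega>" "\<forall>z\<in>(\<Union>i\<le>N. \<Phi> i n ` K). norm (h z - F z) < \<epsilon>"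
    by (elim exE conjE) (rule that)
  have "norm (h (\<Phi> i n z) - g i z) < \<epsilon>" if "i \<le> N" "z \<in> K" for i z
  proof -
    have "\<Phi> i n z \<in> V i" "z \<in> \<Omega>" using MV[OF that(1)] K1 that(2) by (auto simp: M_def)
    then have "F (\<Phi> i n z) = g i z" using F[OF that(1)] q(2)[OF that(1)] by simp
    moreover have "norm (h (\<Phi> i n z) - F (\<Phi> i n z)) < \<epsilon>"
      by (rule bspec[OF h(2)]) (use that in blast)
    ultimately show ?thesis by simp
  qed
  then show ?thesis by (rule that[OF h(1)])
qed

text \<open>On the i-th image of \<open>K\<close>, \<open>f\<close> stays within 2 of
  \<open>10 * i\<close>: 1 from the approximation and 1 from \<open>h\<close>. Values on different
  images are therefore distinct.\<close>

lemma good_if_approximation: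
  assumes K: "convex_relative \<Omega> K" "K \<noteq> {}" and L: "K \<subseteq> L" "L \<subseteq> \<Omega>"
    and h: "\<And>z. z \<in> K \<Longrightarrow> norm (h z) < 1" "\<And>C. C \<in> components (- K) \<Longrightarrow> \<exists>q\<in>C \<inter> L. norm (h q - 5) < 1"
    and f: "f holomorphic_on \<Omega>"
      "\<And>i z. i \<le> N \<Longrightarrow> z \<in> L \<Longrightarrow> norm (f (\<Phi> i n z) - (h z + of_nat (10 * i))) < 1"
  shows "good K n"
proof -
  have "convex_relative \<Omega> (\<Phi> i n ` K)" if "i \<le> N" for i
    using convex_relative_image_if_approximation[OF open_\<Omega> connected_\<Omega> K \<Phi>_holo[OF that] \<Phi>_inj[OF that]
        \<Phi>_into[OF that] L h f(1) f(2)[OF that]] .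
  moreover have "disjoint_family_on (\<lambda>i. \<Phi> i n ` K) {..N}"
  proof (rule ccontr)
    assume "\<not> ?thesis"
    then obtain i j z w where ij: "i \<le> N" "j \<le> N" "i \<noteq> j" "z \<in> K" "w \<in> K" "\<Phi> i n z = \<Phi> j n w"
      by (auto simp: disjoint_family_on_def)
    have near: "norm (f (\<Phi> i n z) - of_nat (10 * i)) < 2" if "i \<le> N" "z \<in> K" for i z
    proof -
      have "f (\<Phi> i n z) - of_nat (10 * i) = (f (\<Phi> i n z) - (h z + of_nat (10 * i))) + h z" by simp
      then show ?thesis
        using norm_triangle_ineq[of "f (\<Phi> i n z) - (h z + of_nat (10 * i))" "h z"] f(2)[of i z] h(1)[of z] that L(1)
        by (smt (verit) subsetD)
    qed
    have "norm (of_nat (10 * i) - of_nat (10 * j) :: complex) < 4"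
      using near[OF ij(1,4)] near[OF ij(2,5)] ij(6)
        norm_triangle_ineq4[of "f (\<Phi> j n w) - of_nat (10 * j)" "f (\<Phi> i n z) - of_nat (10 * i)"] by simp
    moreover have "norm (of_nat (10 * i) - of_nat (10 * j) :: complex) = \<bar>real (10 * i) - real (10 * j)\<bar>"
      by (metis norm_of_real of_real_diff of_real_of_nat_eq)
    ultimately show False using ij(3) by linarith
  qed
  ultimately show ?thesis by (simp add: good_def)
qed

end

theorem theorem4p1:
  fixes F :: "nat set set" and \<Omega> :: "complex set" and N :: nat
    and \<phi> :: "nat \<Rightarrow> complex \<Rightarrow> complex"
  assumes "furstenberg_family F"
    and "plane_domain \<Omega>" and "\<not> finitely_connected \<Omega>"
    and "N \<ge> 2"
    and "\<And>i. i \<in> {1..N} \<Longrightarrow> \<phi> i holomorphic_on \<Omega>"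
    and "\<And>i. i \<in> {1..N} \<Longrightarrow> \<phi> i ` \<Omega> \<subseteq> \<Omega>"
    and "\<And>i. i \<in> {1..N} \<Longrightarrow> inj_on (\<phi> i) \<Omega>"
  shows "disjoint_transitive F (holomorphic_topology \<Omega>) N (\<lambda>i. composition_operator \<Omega> (\<phi> i)) \<longleftrightarrow>
    (\<forall>K. convex_relative \<Omega> K \<longrightarrow>
       {n. n \<ge> 1 \<and> (\<forall>i\<in>{1..N}. convex_relative \<Omega> ((\<phi> i ^^ n) ` K)) \<and>
           disjoint_family_on (\<lambda>i. if i = 0 then K else (\<phi> i ^^ n) ` K) {0..N}} \<in> F)"
proof -
  define \<psi> where "\<psi> = (\<lambda>i. if i = 0 then id else \<phi> i)"
  have \<Omega>: "open \<Omega>" "connected \<Omega>" "\<Omega> \<noteq> {}" using assms(2) by (auto simp: plane_domain_def)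
  interpret injective_self_maps \<Omega> N \<psi>
  proof
    fix i assume "i \<le> N"
    then consider "i = 0" | "i \<in> {1..N}" by fastforce
    note cases = this
    show "\<psi> i holomorphic_on \<Omega>" "\<psi> i ` \<Omega> \<subseteq> \<Omega>" "inj_on (\<psi> i) \<Omega>"
      using assms(5-7) by (cases rule: cases; simp add: \<psi>_def id_def)+
  qed (use \<Omega> assms(4) in \<open>auto simp: \<psi>_def\<close>)
  have \<psi>_pos: "\<psi> i ^^ n = \<phi> i ^^ n" if "i \<noteq> 0" for i n using that by (simp add: \<psi>_def)
  have up: "B \<in> F" if "A \<in> F" "A \<subseteq> B" "B \<subseteq> {1..}" for A B
    using assms(1) that unfolding furstenberg_family_def by blast
  define G where "G = (\<lambda>K. {n. n \<ge> 1 \<and> (\<forall>i\<in>{1..N}. convex_relative \<Omega> ((\<phi> i ^^ n) ` K)) \<and>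
           disjoint_family_on (\<lambda>i. if i = 0 then K else (\<phi> i ^^ n) ` K) {0..N}})"
  have G: "G K = {n. n \<ge> 1 \<and> good K n}" if "convex_relative \<Omega> K" for K
  proof -
    have "(\<lambda>i. (\<psi> i ^^ n) ` K) = (\<lambda>i. if i = 0 then K else (\<phi> i ^^ n) ` K)" for n
      by (auto simp: fun_eq_iff \<psi>_pos \<Phi>_0)
    moreover have "(\<forall>i\<le>N. convex_relative \<Omega> ((\<psi> i ^^ n) ` K)) \<longleftrightarrow>
        (\<forall>i\<in>{1..N}. convex_relative \<Omega> ((\<phi> i ^^ n) ` K))" for n
    proof -
      have "{..N} = insert 0 {1..N}" by auto
      then have "(\<forall>i\<le>N. convex_relative \<Omega> ((\<psi> i ^^ n) ` K)) \<longleftrightarrow>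
          (\<forall>i\<in>insert 0 {1..N}. convex_relative \<Omega> ((\<psi> i ^^ n) ` K))" by (metis atMost_iff)
      then show ?thesis using that by (simp add: \<Phi>_0 \<psi>_pos)
    qed
    ultimately show ?thesis by (simp add: G_def good_def atLeast0AtMost)
  qed
  have funpow: "(composition_operator \<Omega> (\<phi> i) ^^ n) f = restrict (f \<circ> (\<psi> i ^^ n)) \<Omega>"
    if "f \<in> holomorphic_functions \<Omega>" "i \<in> {1..N}" for f i n
    using composition_operator_funpow[OF that(1) assms(6)[OF that(2)]] that(2) by (simp add: \<psi>_pos)
  define hit where "hit = (\<lambda>U. {n. n \<ge> 1 \<and> U 0 \<inter> (\<Inter>i\<in>{1..N}.
      {f \<in> holomorphic_functions \<Omega>. (composition_operator \<Omega> (\<phi> i) ^^ n) f \<in> U i}) \<noteq> {}})"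
  have "G K \<in> F" if T: "\<And>U. (\<And>j. j \<le> N \<Longrightarrow> openin (holomorphic_topology \<Omega>) (U j) \<and> U j \<noteq> {}) \<Longrightarrow> hit U \<in> F"
    and K: "convex_relative \<Omega> K" for K
  proof (cases "K = {}")
    \<comment> \<open>For empty \<open>K\<close> there is no component argument, but every positive
      time qualifies, and \<open>{1..}\<close> belongs to any Furstenberg family.\<close>
    case True
    have "G K = {1..}" using True K by (auto simp: G_def disjoint_family_on_def)
    moreover obtain A where "A \<in> F" "A \<subseteq> {1..}" using assms(1) unfolding furstenberg_family_def by blast
    ultimately show ?thesis using up by simp
  next
    case False
    obtain h L where h: "h holomorphic_on \<Omega>" "compact L" "K \<subseteq> L" "L \<subseteq> \<Omega>"
      "\<And>z. z \<in> K \<Longrightarrow> norm (h z) < 1" "\<And>C. C \<in> components (- K) \<Longrightarrow> \<exists>q\<in>C \<inter> L. norm (h q - 5) < 1"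
      using function_large_on_complementary_components[OF K False \<Omega>(1)] by blast
    define g where "g = (\<lambda>i::nat. \<lambda>z\<in>\<Omega>. h z + of_nat (10 * i))"
    have g: "g i \<in> holomorphic_functions \<Omega>" for i
    proof -
      have "(\<lambda>z. h z + of_nat (10 * i)) holomorphic_on \<Omega>" by (intro holomorphic_intros h(1))
      then have "g i holomorphic_on \<Omega>" by (rule holomorphic_transform) (simp add: g_def)
      then show ?thesis by (simp add: holomorphic_functions_def g_def)
    qed
    define U where "U = (\<lambda>i. holomorphic_nhd \<Omega> (g i) L 1)"
    have "hit U \<in> F"
    proof (rule T)
      fix j
      have "g j \<in> U j" using g by (simp add: U_def holomorphic_nhd_def)
      then show "openin (holomorphic_topology \<Omega>) (U j) \<and> U j \<noteq> {}"
        using openin_holomorphic_nhd[of "g j" \<Omega> L 1] g h(2,4) by (auto simp: U_def holomorphic_functions_def)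
    qed
    moreover have "hit U \<subseteq> G K"
    proof
      fix n assume "n \<in> hit U"
      then have "n \<ge> 1" "U 0 \<inter> (\<Inter>i\<in>{1..N}.
          {f \<in> holomorphic_functions \<Omega>. (composition_operator \<Omega> (\<phi> i) ^^ n) f \<in> U i}) \<noteq> {}"
        by (simp_all add: hit_def)
      then obtain f where f: "n \<ge> 1" "f \<in> U 0" "\<And>i. i \<in> {1..N} \<Longrightarrow> (composition_operator \<Omega> (\<phi> i) ^^ n) f \<in> U i"
        by blast
      have fh: "f \<in> holomorphic_functions \<Omega>" using f(2) by (simp add: U_def holomorphic_nhd_def)
      have "norm (f ((\<psi> i ^^ n) z) - (h z + of_nat (10 * i))) < 1" if "i \<le> N" "z \<in> L" for i z
      proof (cases "i = 0")
        case True
        have "z \<in> \<Omega>" using that h(4) by blast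
        moreover have "dist (f z) (g 0 z) < 1" using f(2) that(2) by (simp add: U_def holomorphic_nhd_def)
        ultimately show ?thesis using True by (simp add: g_def \<Phi>_0 dist_norm)
      next
        case False
        then have "i \<in> {1..N}" using that by simp
        moreover have "z \<in> \<Omega>" using that h(4) by blast
        moreover have "dist ((composition_operator \<Omega> (\<phi> i) ^^ n) f z) (g i z) < 1"
          using f(3)[of i] calculation(1) that(2) by (simp add: U_def holomorphic_nhd_def)
        ultimately show ?thesis using funpow[OF fh, of i n] by (simp add: g_def dist_norm)
      qed
      then have "good K n"
        using good_if_approximation[OF K False h(3,4,5,6)] fh by (auto simp: holomorphic_functions_def)
      then show "n \<in> G K" using G[OF K] f(1) by simp
    qed
    moreover have "G K \<subseteq> {1..}" by (auto simp: G_def)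
    ultimately show ?thesis by (rule up)
  qed
  moreover have "hit U \<in> F" if cond: "\<And>K. convex_relative \<Omega> K \<Longrightarrow> G K \<in> F"
    and U: "\<And>j. j \<le> N \<Longrightarrow> openin (holomorphic_topology \<Omega>) (U j) \<and> U j \<noteq> {}" for U
  proof -
    have "\<exists>g K \<epsilon>. g \<in> U j \<and> compact K \<and> K \<subseteq> \<Omega> \<and> \<epsilon> > 0 \<and> holomorphic_nhd \<Omega> g K \<epsilon> \<subseteq> U j" if "j \<le> N" for j
      using U[OF that] unfolding openin_holomorphic_topology by blast
    then obtain g KK \<epsilon> where gU: "\<And>j. j \<le> N \<Longrightarrow> g j \<in> U j \<and> compact (KK j) \<and> KK j \<subseteq> \<Omega> \<and> \<epsilon> j > (0::real) \<and>
        holomorphic_nhd \<Omega> (g j) (KK j) (\<epsilon> j) \<subseteq> U j" by metis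
    have g: "g j holomorphic_on \<Omega>" if "j \<le> N" for j
      using gU[OF that] U[OF that] openin_subset by (fastforce simp: holomorphic_functions_def)
    have "compact (\<Union>j\<le>N. KK j)" "(\<Union>j\<le>N. KK j) \<subseteq> \<Omega>" using gU by (auto intro!: compact_UN)
    then obtain K R where K: "convex_relative \<Omega> K" "connected K" "K \<noteq> {}" "(\<Union>j\<le>N. KK j) \<subseteq> K"
      "R \<subseteq> \<Omega>" "finite R" "card R = N + 2" "separated_points K R"
      using convex_relative_superset_with_separated_points[OF \<Omega> assms(3)] by metis
    \<comment> \<open>Approximation takes place on \<open>K\<close>, while the times are those good
      for the larger \<open>K'\<close>; these make the union of the images of \<open>K\<close>
      \<Omega>-convex.\<close>
    obtain K' where K': "convex_relative \<Omega> K'" "K \<subseteq> K'"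
      "\<And>n. good K' n \<Longrightarrow> convex_relative \<Omega> (\<Union>i\<le>N. (\<psi> i ^^ n) ` K)"
      using eventually_union_convex_relative[OF K(1-3,5-8)] by blast
    define \<delta> where "\<delta> = Min (\<epsilon> ` {..N})"
    have \<delta>: "\<delta> > 0" "\<And>j. j \<le> N \<Longrightarrow> \<delta> \<le> \<epsilon> j" using gU by (auto simp: \<delta>_def)
    have "G K' \<subseteq> hit U"
    proof
      fix n assume "n \<in> G K'"
      then have n: "n \<ge> 1" "good K' n" using G[OF K'(1)] by auto
      obtain h where h: "h holomorphic_on \<Omega>"
        "\<And>i z. i \<le> N \<Longrightarrow> z \<in> K \<Longrightarrow> norm (h ((\<psi> i ^^ n) z) - g i z) < \<delta>"
        using simultaneous_approximation[OF K(1,3) good_subset[OF n(2) K'(1) K(1) K'(2)] K'(3)[OF n(2)], of g] g \<delta>(1)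
        by blast
      define f where "f = restrict h \<Omega>"
      have "f holomorphic_on \<Omega>" using h(1) by (rule holomorphic_transform) (simp add: f_def)
      then have fh: "f \<in> holomorphic_functions \<Omega>" by (simp add: holomorphic_functions_def f_def)
      have mem: "restrict (f \<circ> (\<psi> i ^^ n)) \<Omega> \<in> U i" if i: "i \<le> N" for i
      proof -
        have "(f \<circ> (\<psi> i ^^ n)) holomorphic_on \<Omega>"
          using holomorphic_on_compose_gen[OF \<Phi>_holo[OF i] _ \<Phi>_into[OF i]] \<open>f holomorphic_on \<Omega>\<close> by blast
        then have "restrict (f \<circ> (\<psi> i ^^ n)) \<Omega> holomorphic_on \<Omega>" by (rule holomorphic_transform) simp
        moreover have "dist (restrict (f \<circ> (\<psi> i ^^ n)) \<Omega> z) (g i z) < \<epsilon> i" if z: "z \<in> KK i" for z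
        proof -
          have "z \<in> K" "z \<in> \<Omega>" using z i K(4) gU[OF i] by auto
          moreover have "(\<psi> i ^^ n) z \<in> \<Omega>" using \<Phi>_into[OF i, of n] \<open>z \<in> \<Omega>\<close> by blast
          ultimately show ?thesis using h(2)[OF i, of z] \<delta>(2)[OF i] by (simp add: f_def dist_norm)
        qed
        ultimately have "restrict (f \<circ> (\<psi> i ^^ n)) \<Omega> \<in> holomorphic_nhd \<Omega> (g i) (KK i) (\<epsilon> i)"
          by (simp add: holomorphic_nhd_def holomorphic_functions_def)
        then show ?thesis using gU[OF i] by blast
      qed
      have "f \<in> U 0" using mem[of 0] by (simp add: \<Phi>_0 f_def)
      moreover have "(composition_operator \<Omega> (\<phi> i) ^^ n) f \<in> U i" if "i \<in> {1..N}" for i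
        using mem[of i] funpow[OF fh that, of n] that by simp
      ultimately show "n \<in> hit U" using n(1) fh by (auto simp: hit_def)
    qed
    then show ?thesis using up[OF cond[OF K'(1)]] by (auto simp: hit_def)
  qed
  ultimately show ?thesis
    unfolding disjoint_transitive_def topspace_holomorphic_topology atLeast0AtMost G_def hit_def
    by (auto simp: atMost_iff)
qed

end
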